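(* Let $G$ be a connected graph and let $G_{\mathrm{virt}}$ be a virtual graph extending $G$ with at most $\beta$ virtual nodes, distributedly stored in $G$. Suppose $A_{\mathrm{virt}}$ is a (deterministic) $\tau$-round Minor-Aggregation algorithm on $G_{\mathrm{virt}}$. Then $A_{\mathrm{virt}}$ can be simulated by a (deterministic) $\tau\cdot O(\beta+1)$-round Minor-Aggregation algorithm on $G$. Upon termination, each non-virtual node $v \in V(G)$ learns all information learned by $v$ and by all virtual nodes in $A_{\mathrm{virt}}$.
   Context: Minor-Aggregation model. The communication network is a connected undirected graph $G=(V,E)$ with $n=|V|$ nodes; both nodes and edges are computational units with private memory. Initially nodes know only their unique $\tilde O(1)$-bit ID (and inputs) and edges know the IDs of their endpoints. Computation proceeds in synchronous rounds, each of three steps: (i) Contraction: each edge $e$ chooses $c_e\in\{\bot,\top\}$, defining the minor $G'=G/\{e:c_e=\top\}$ (self-loops removed), whose vertices (supernodes) are identified with the sets of nodes they contain. (ii) Consensus: each node $v$ chooses an $\tilde O(1)$-bit value $x_v$; for each supernode $s$ all nodes of $s$ learn $y_s=\bigoplus_{v\in s}x_v$ for a predefined aggregation operator $\bigoplus$. (iii) Aggregation: each edge $e$ of $G'$ joining supernodes $a,b$ learns $y_a,y_b$ and chooses $\tilde O(1)$-bit values $z_{e,a},z_{e,b}$; all nodes of each supernode $s$ learn the same aggregate $\bigotimes_{e \text{ incident to } s} z_{e,s}$ for a predefined aggregation operator $\bigotimes$. An aggregation operator maps two $B$-bit messages ($B=\tilde O(1)$) to one $B$-bit message; the aggregate of several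 messages is obtained by repeatedly replacing two messages by their combination in an arbitrary order. $\tilde O(\cdot)$ hides $\mathrm{poly}(\log n)$ factors. Virtual graphs: a virtual graph $G_{\mathrm{virt}}$ extending $G=(V,E)$ is a graph with $V(G_{\mathrm{virt}})=V\sqcup V_{\mathrm{virt}}$ (the nodes of $V_{\mathrm{virt}}$ are virtual nodes) containing $G$, with arbitrary additional edges each incident to at least one virtual node (virtual edges); it has at most $\beta$ virtual nodes if $|V_{\mathrm{virt}}|\le\beta$. It is distributedly stored in $G$ if all nodes of $G$ know the list of IDs of all virtual nodes, each virtual edge between a non-virtual $u$ and a virtual $v$ is known to $u$, and each virtual edge between two virtual nodes is known to all nodes. *)

theory Defs
  imports "HOL-Probability.Probability"
begin

text \<open>Nodes are identified with their unique IDs, which are bit strings. An edge is the set of its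
  two end points, so an edge that knows itself knows exactly the IDs of its end points.\<close>

type_synonym node = "bool list"
type_synonym msg = "bool list"

record graph =
  verts :: "node set"
  edges :: "node set set"

definition simple_graph :: "graph \<Rightarrow> bool" where
  "simple_graph G \<longleftrightarrow> finite (verts G) \<and> (\<forall>e\<in>edges G. e \<subseteq> verts G \<and> card e = 2)"

definition link :: "node set set \<Rightarrow> (node \<times> node) set" where
  "link F = {(u, v). {u, v} \<in> F}"

definition connected_graph :: "graph \<Rightarrow> bool" where
  "connected_graph G \<longleftrightarrow> verts G \<noteq> {} \<and>
     (\<forall>u\<in>verts G. \<forall>v\<in>verts G. (u, v) \<in> (link (edges G))\<^sup>*)"

text \<open>The minor obtained by contracting the edge set \<open>F\<close>: its vertices are the supernodes, and its
  edges are the edges of \<open>G\<close> that do not become self-loops (parallel edges are kept).\<close>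

definition supernode_of :: "graph \<Rightarrow> node set set \<Rightarrow> node \<Rightarrow> node set" where
  "supernode_of G F v = {u \<in> verts G. (v, u) \<in> (link F)\<^sup>*}"

definition supernodes :: "graph \<Rightarrow> node set set \<Rightarrow> node set set" where
  "supernodes G F = supernode_of G F ` verts G"

definition minor_edges :: "graph \<Rightarrow> node set set \<Rightarrow> node set set" where
  "minor_edges G F = {e \<in> edges G. \<not> (\<exists>s\<in>supernodes G F. e \<subseteq> s)}"

text \<open>\<open>aggregates f M m\<close>: \<open>m\<close> is a possible result of repeatedly replacing two messages of \<open>M\<close> by
  their combination. As \<open>f\<close> need be neither associative nor commutative, this is a relation.\<close>

inductive aggregates :: "(msg \<Rightarrow> msg \<Rightarrow> msg) \<Rightarrow> msg multiset \<Rightarrow> msg \<Rightarrow> bool"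
  for f :: "msg \<Rightarrow> msg \<Rightarrow> msg" where
  single: "aggregates f {#m#} m"
| combine: "aggregates f (add_mset (f a b) M) m \<Longrightarrow> aggregates f (add_mset a (add_mset b M)) m"

text \<open>A supernode without incident edges has nothing to aggregate and learns \<open>None\<close>.\<close>

definition aggregates_opt :: "(msg \<Rightarrow> msg \<Rightarrow> msg) \<Rightarrow> msg multiset \<Rightarrow> msg option \<Rightarrow> bool" where
  "aggregates_opt f M r \<longleftrightarrow> (case r of None \<Rightarrow> M = {#} | Some m \<Rightarrow> aggregates f M m)"

text \<open>Nodes and edges are the computational units. Each owns a private tape of random bits; a
  deterministic algorithm is one that ignores the tapes. \<open>coin_space\<close> makes all the bits
  independent and fair.\<close>

datatype unit_of_computation = Node node | Edge "node set"

definition units :: "graph \<Rightarrow> unit_of_computation set" where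
  "units G = Node ` verts G \<union> Edge ` edges G"

type_synonym tape = "nat \<Rightarrow> bool"
type_synonym coins = "unit_of_computation \<times> nat \<Rightarrow> bool"

definition coin_space :: "graph \<Rightarrow> coins measure" where
  "coin_space G = PiM (units G \<times> UNIV) (\<lambda>_. measure_pmf (pmf_of_set UNIV))"

text \<open>Private memory is unbounded, so a unit may be assumed to remember everything: its initial
  knowledge, and for every past round what it learned in that round. For a node this is the pair of
  the consensus value and the aggregate of its supernode. For an edge it is the consensus value at
  each of its two end points, and the empty set if the edge is a self-loop of the minor.\<close>

type_synonym node_log = "(msg \<times> msg option) list"
type_synonym edge_log = "(node \<times> msg) set list"

record 'i node_view =
  node_id :: node
  node_input :: 'i
  node_tape :: tape
  node_learned :: node_log

record edge_view =
  edge_ends :: "node set"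
  edge_tape :: tape
  edge_learned :: edge_log

text \<open>All choices are functions of the local view. \<open>agg_value\<close> is evaluated after the edge has
  learned the consensus values of the current round; its second argument is the end point lying
  in the supernode that the value is addressed to. The predefined operators may differ from round
  to round and therefore take the round number.\<close>

record 'i ma_algorithm =
  rounds :: nat
  contracts :: "edge_view \<Rightarrow> bool"
  cons_value :: "'i node_view \<Rightarrow> msg"
  agg_value :: "edge_view \<Rightarrow> node \<Rightarrow> msg"
  cons_op :: "nat \<Rightarrow> msg \<Rightarrow> msg \<Rightarrow> msg"
  agg_op :: "nat \<Rightarrow> msg \<Rightarrow> msg \<Rightarrow> msg"

definition bit_bounded :: "nat \<Rightarrow> 'i ma_algorithm \<Rightarrow> bool" where
  "bit_bounded b A \<longleftrightarrow>
     (\<forall>w. length (cons_value A w) \<le> b) \<and>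
     (\<forall>w u. length (agg_value A w u) \<le> b) \<and>
     (\<forall>t x y. length x \<le> b \<longrightarrow> length y \<le> b \<longrightarrow>
        length (cons_op A t x y) \<le> b \<and> length (agg_op A t x y) \<le> b)"

definition deterministic :: "'i ma_algorithm \<Rightarrow> bool" where
  "deterministic A \<longleftrightarrow>
     (\<forall>w r. contracts A (w\<lparr>edge_tape := r\<rparr>) = contracts A w) \<and>
     (\<forall>w r. cons_value A (w\<lparr>node_tape := r\<rparr>) = cons_value A w) \<and>
     (\<forall>w r u. agg_value A (w\<lparr>edge_tape := r\<rparr>) u = agg_value A w u)"

record config =
  nlog :: "node \<Rightarrow> node_log"
  elog :: "node set \<Rightarrow> edge_log"

definition nview :: "(node \<Rightarrow> 'i) \<Rightarrow> coins \<Rightarrow> config \<Rightarrow> node \<Rightarrow> 'i node_view" where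
  "nview inp \<omega> c v = \<lparr>node_id = v, node_input = inp v, node_tape = (\<lambda>k. \<omega> (Node v, k)),
     node_learned = nlog c v\<rparr>"

definition eview :: "coins \<Rightarrow> config \<Rightarrow> node set \<Rightarrow> edge_view" where
  "eview \<omega> c e = \<lparr>edge_ends = e, edge_tape = (\<lambda>k. \<omega> (Edge e, k)), edge_learned = elog c e\<rparr>"

text \<open>One round. \<open>y\<close> and \<open>z\<close> give, for every supernode, the outcome of the consensus step and
  of the aggregation step.\<close>

definition ma_round ::
  "'i ma_algorithm \<Rightarrow> graph \<Rightarrow> (node \<Rightarrow> 'i) \<Rightarrow> coins \<Rightarrow> nat \<Rightarrow> config \<Rightarrow> config \<Rightarrow> bool" where
  "ma_round A G inp \<omega> t c c' \<longleftrightarrow>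
     (let F = {e \<in> edges G. contracts A (eview \<omega> c e)}; sn = supernode_of G F in
      \<exists>y z.
        (\<forall>s\<in>supernodes G F. aggregates (cons_op A t)
           (image_mset (\<lambda>v. cons_value A (nview inp \<omega> c v)) (mset_set s)) (y s)) \<and>
        (\<forall>e\<in>edges G. elog c' e =
           elog c e @ [if e \<in> minor_edges G F then (\<lambda>u. (u, y (sn u))) ` e else {}]) \<and>
        (\<forall>s\<in>supernodes G F. aggregates_opt (agg_op A t)
           (image_mset (\<lambda>(e, u). agg_value A (eview \<omega> c' e) u)
              (mset_set {(e, u). e \<in> minor_edges G F \<and> u \<in> e \<inter> s})) (z s)) \<and>
        (\<forall>v\<in>verts G. nlog c' v = nlog c v @ [(y (sn v), z (sn v))]))"

inductive reaches ::
  "'i ma_algorithm \<Rightarrow> graph \<Rightarrow> (node \<Rightarrow> 'i) \<Rightarrow> coins \<Rightarrow> nat \<Rightarrow> config \<Rightarrow> bool"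
  for A G inp \<omega> where
  start: "reaches A G inp \<omega> 0 \<lparr>nlog = (\<lambda>_. []), elog = (\<lambda>_. [])\<rparr>"
| step: "reaches A G inp \<omega> t c \<Longrightarrow> ma_round A G inp \<omega> t c c' \<Longrightarrow> reaches A G inp \<omega> (Suc t) c'"

definition terminates_in ::
  "'i ma_algorithm \<Rightarrow> graph \<Rightarrow> (node \<Rightarrow> 'i) \<Rightarrow> coins \<Rightarrow> config \<Rightarrow> bool" where
  "terminates_in A G inp \<omega> c \<longleftrightarrow> reaches A G inp \<omega> (rounds A) c"

definition virtual_nodes :: "graph \<Rightarrow> graph \<Rightarrow> node set" where
  "virtual_nodes G Gv = verts Gv - verts G"

definition virtual_edges :: "graph \<Rightarrow> graph \<Rightarrow> node set set" where
  "virtual_edges G Gv = edges Gv - edges G"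

definition virtual_graph :: "graph \<Rightarrow> graph \<Rightarrow> bool" where
  "virtual_graph G Gv \<longleftrightarrow> simple_graph Gv \<and> verts G \<subseteq> verts Gv \<and> edges G \<subseteq> edges Gv \<and>
     (\<forall>e\<in>virtual_edges G Gv. e \<inter> virtual_nodes G Gv \<noteq> {})"

text \<open>The part of the virtual graph that is stored at one node. A virtual node may have an input,
  which is then known wherever the virtual node is known; virtual nodes without input are the case
  of a constant \<open>inp\<close> on the virtual nodes.\<close>

record 'i storage =
  virt_ids :: "node list"
  virt_input :: "node \<Rightarrow> 'i"
  virt_incident :: "node set set"
  virt_virt :: "node set set"

definition distributedly_stored ::
  "graph \<Rightarrow> graph \<Rightarrow> (node \<Rightarrow> 'i) \<Rightarrow> (node \<Rightarrow> 'i storage) \<Rightarrow> bool" where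
  "distributedly_stored G Gv inp st \<longleftrightarrow>
     (\<forall>u\<in>verts G.
        set (virt_ids (st u)) = virtual_nodes G Gv \<and>
        (\<forall>w\<in>virtual_nodes G Gv. virt_input (st u) w = inp w) \<and>
        virt_incident (st u) = {e \<in> virtual_edges G Gv. u \<in> e} \<and>
        virt_virt (st u) = {e \<in> virtual_edges G Gv. e \<subseteq> virtual_nodes G Gv})"

text \<open>\<open>A\<close> on \<open>G\<close> simulates \<open>Av\<close> on \<open>Gv\<close>: the fair coins of \<open>G\<close> are turned into fair coins of \<open>Gv\<close>
  such that every execution of \<open>A\<close> yields an execution of \<open>Av\<close>, and what a node \<open>v\<close> of \<open>G\<close> knows at
  the end of the former determines, via \<open>dec\<close>, what \<open>v\<close> and all the virtual nodes have learned in
  the latter.\<close>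

definition simulates ::
  "('i \<times> 'i storage) ma_algorithm \<Rightarrow>
   (node \<Rightarrow> 'i \<times> 'i storage \<Rightarrow> node_log \<Rightarrow> node \<Rightarrow> node_log) \<Rightarrow>
   'i ma_algorithm \<Rightarrow> graph \<Rightarrow> graph \<Rightarrow> (node \<Rightarrow> 'i) \<Rightarrow> (node \<Rightarrow> 'i storage) \<Rightarrow> bool" where
  "simulates A dec Av G Gv inp st \<longleftrightarrow>
     (\<exists>\<Phi> \<in> coin_space G \<rightarrow>\<^sub>M coin_space Gv.
        distr (coin_space G) (coin_space Gv) \<Phi> = coin_space Gv \<and>
        (\<forall>\<omega>\<in>space (coin_space G). \<forall>c.
           terminates_in A G (\<lambda>u. (inp u, st u)) \<omega> c \<longrightarrow>
           (\<exists>cv. terminates_in Av Gv inp (\<Phi> \<omega>) cv \<and>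
              (\<forall>v\<in>verts G. \<forall>w\<in>insert v (virtual_nodes G Gv).
                 dec v (inp v, st v) (nlog c v) w = nlog cv w))))"

definition soft_O_one :: "(nat \<Rightarrow> nat) \<Rightarrow> bool" where
  "soft_O_one B \<longleftrightarrow> (\<exists>k. (\<lambda>n. real (B n)) \<in> O(\<lambda>n. ln (real n) ^ k))"

text \<open>Executions exist, so quantifying over all of them is not vacuous.\<close>

lemma aggregates_exists: "M \<noteq> {#} \<Longrightarrow> \<exists>m. aggregates f M m"
proof (induction "size M" arbitrary: M rule: less_induct)
  case less
  then obtain a N where M: "M = add_mset a N" by (meson multiset_cases)
  show ?case
  proof (cases N)
    case empty
    then show ?thesis using M aggregates.single by auto
  next
    case (add b K)
    have "\<exists>m. aggregates f (add_mset (f a b) K) m"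
      by (rule less.hyps) (auto simp: M add)
    then show ?thesis using M add aggregates.combine by blast
  qed
qed

lemma aggregates_opt_exists: "\<exists>r. aggregates_opt f M r"
proof (cases "M = {#}")
  case True
  then show ?thesis unfolding aggregates_opt_def by (intro exI[of _ None]) simp
next
  case False
  then obtain m where "aggregates f M m" using aggregates_exists by blast
  then show ?thesis unfolding aggregates_opt_def by (intro exI[of _ "Some m"]) simp
qed

lemma ma_round_exists:
  assumes "finite (verts G)"
  shows "\<exists>c'. ma_round A G inp \<omega> t c c'"
proof -
  define F where "F = {e \<in> edges G. contracts A (eview \<omega> c e)}"
  define sn where "sn = supernode_of G F"
  have "\<forall>s\<in>supernodes G F. \<exists>m. aggregates (cons_op A t)
           (image_mset (\<lambda>v. cons_value A (nview inp \<omega> c v)) (mset_set s)) m"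
  proof
    fix s assume "s \<in> supernodes G F"
    then have "finite s" "s \<noteq> {}"
      using assms by (auto simp: supernodes_def supernode_of_def)
    then show "\<exists>m. aggregates (cons_op A t)
           (image_mset (\<lambda>v. cons_value A (nview inp \<omega> c v)) (mset_set s)) m"
      by (intro aggregates_exists) (simp add: mset_set_empty_iff)
  qed
  from bchoice[OF this] obtain y where y: "\<forall>s\<in>supernodes G F. aggregates (cons_op A t)
           (image_mset (\<lambda>v. cons_value A (nview inp \<omega> c v)) (mset_set s)) (y s)"
    ..
  define el where "el = (\<lambda>e. elog c e @
     [if e \<in> minor_edges G F then (\<lambda>u. (u, y (sn u))) ` e else {}])"
  define ev where "ev = (\<lambda>e. \<lparr>edge_ends = e, edge_tape = (\<lambda>k. \<omega> (Edge e, k)), edge_learned = el e\<rparr>)"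
  obtain z where z: "\<And>s. aggregates_opt (agg_op A t)
           (image_mset (\<lambda>(e, u). agg_value A (ev e) u)
              (mset_set {(e, u). e \<in> minor_edges G F \<and> u \<in> e \<inter> s})) (z s)"
  proof -
    have "\<forall>s. \<exists>r. aggregates_opt (agg_op A t)
           (image_mset (\<lambda>(e, u). agg_value A (ev e) u)
              (mset_set {(e, u). e \<in> minor_edges G F \<and> u \<in> e \<inter> s})) r"
      by (intro allI aggregates_opt_exists)
    from choice[OF this] show thesis by (elim exE) (rule that, erule spec)
  qed
  define c' where "c' = \<lparr>nlog = (\<lambda>v. nlog c v @ [(y (sn v), z (sn v))]), elog = el\<rparr>"
  have "eview \<omega> c' = ev" by (auto simp: eview_def c'_def ev_def)
  then have "ma_round A G inp \<omega> t c c'"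
    unfolding ma_round_def Let_def F_def[symmetric] sn_def[symmetric]
    by (intro exI[of _ y] exI[of _ z]) (use y z in \<open>auto simp: c'_def el_def\<close>)
  then show ?thesis ..
qed

lemma terminates_in_exists:
  assumes "finite (verts G)"
  shows "\<exists>c. terminates_in A G inp \<omega> c"
proof -
  have "\<exists>c. reaches A G inp \<omega> t c" for t
  proof (induction t)
    case 0
    show ?case by (rule exI) (rule reaches.start)
  next
    case (Suc t)
    then obtain c where c: "reaches A G inp \<omega> t c" ..
    obtain c' where "ma_round A G inp \<omega> t c c'" using ma_round_exists[OF assms] ..
    with c show ?case by (intro exI) (rule reaches.step)
  qed
  then show ?thesis by (simp add: terminates_in_def)
qed

end

theory Submission
  imports Defs
begin

text \<open>Every round on the virtual graph is simulated by a phase of \<open>3\<beta> + 5\<close> rounds on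
  \<open>G\<close>. The node of minimal ID is the leader; it runs the virtual nodes and the edges between
  them, while a virtual edge with an end point \<open>u\<close> in \<open>G\<close> is run by
  \<open>u\<close>. Contracting the non-virtual contracted edges splits \<open>G\<close> into parts, and every
  part agrees on one virtual node (if any) that it is contracted to. In each of \<open>\<beta>\<close> further
  rounds, with all of \<open>G\<close> contracted to a single supernode, some pair of virtual nodes known to
  be connected but carrying different labels is announced and their labels are merged; as every announcement
  removes a label, afterwards two virtual nodes have the same label iff they lie in the same supernode. So
  everybody knows the supernodes containing virtual nodes, of which there are at most \<open>\<beta>\<close>:
  these are served one by one, by contracting all of \<open>G\<close> and letting only their members
  contribute. All other supernodes are parts and are served simultaneously by contracting the parts.\<close>

subsection \<open>Aggregation\<close>

text \<open>Three obstacles lie behind the details. An aggregation operator need be neither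
  associative nor commutative, so an outcome is just one of several possible results; all that is
  available is that combining messages inside each host first and across hosts afterwards is an
  admissible order. Hence every contribution must be counted at exactly one node. Second, the edges
  of \<open>G\<close> have private memory and tapes, so no node can act for them, and an edge learns
  something only when it is not a self-loop of the current minor. This forces a round without any
  contraction in every phase, in which the end points tell the edge what it would have seen on the
  virtual graph. Third, the coins of the virtual graph must be a measurable function of the coins of
  \<open>G\<close>, fixed before the run; so the leader has to depend on \<open>G\<close> alone, and
  a host splits its single tape among the units that it runs. The number of rounds is
  \<open>1 + 1 + \<beta> + (1 + \<beta>) + 1 + (1 + \<beta>)\<close>.\<close>

definition mset_opt :: "'a option \<Rightarrow> 'a multiset" where
  "mset_opt x = (case x of None \<Rightarrow> {#} | Some a \<Rightarrow> {#a#})"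

lemma mset_opt_simps [simp]: "mset_opt None = {#}" "mset_opt (Some a) = {#a#}"
  by (simp_all add: mset_opt_def)

text \<open>First reduce \<open>N\<close> to \<open>a\<close> next to the idle \<open>M\<close>,
  then go on from there. This is what makes hierarchical aggregation one of the admissible
  orders.\<close>

lemma aggregates_subst:
  "aggregates f N a \<Longrightarrow> aggregates f (add_mset a M) m \<Longrightarrow> aggregates f (N + M) m"
  by (induction rule: aggregates.induct) (auto intro: aggregates.combine)

text \<open>The remainder \<open>M\<close> carries the induction: once the partial result of a node
  is expanded into \<open>N u\<close>, it moves into \<open>M\<close>.\<close>

lemma aggregates_opt_sum_gen:
  assumes "finite S" "\<And>u. u \<in> S \<Longrightarrow> aggregates_opt f (N u) (v u)"
    and "aggregates_opt f ((\<Sum>u\<in>S. mset_opt (v u)) + M) r"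
  shows "aggregates_opt f ((\<Sum>u\<in>S. N u) + M) r"
  using assms
proof (induction S arbitrary: M rule: finite_induct)
  case (insert u S)
  have "aggregates_opt f ((\<Sum>u\<in>S. mset_opt (v u)) + (N u + M)) r"
  proof (cases "v u")
    case None
    then show ?thesis using insert.prems(1)[of u] insert.prems(2) insert.hyps
      by (simp add: aggregates_opt_def)
  next
    case (Some a)
    have "aggregates f (N u) a" using insert.prems(1)[of u] Some by (simp add: aggregates_opt_def)
    moreover obtain m where "r = Some m"
      "aggregates f (add_mset a ((\<Sum>u\<in>S. mset_opt (v u)) + M)) m"
      using insert.prems(2) insert.hyps Some by (cases r) (auto simp: aggregates_opt_def)
    ultimately show ?thesis using aggregates_subst
      by (fastforce simp: aggregates_opt_def add.left_commute)
  qed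
  from insert.IH[OF _ this] insert show ?case by (simp add: ac_simps)
qed simp

lemma aggregates_opt_sum:
  assumes "finite S" "\<And>u. u \<in> S \<Longrightarrow> aggregates_opt f (N u) (v u)"
    and "aggregates_opt f (\<Sum>u\<in>S. mset_opt (v u)) r"
  shows "aggregates_opt f (\<Sum>u\<in>S. N u) r"
  using aggregates_opt_sum_gen[OF assms(1,2), where M = "{#}"] assms(3) by simp

text \<open>Serves two ends: with \<open>g = f\<close> it bounds message lengths, and with
  \<open>g\<close> a truncation of \<open>f\<close> it shows that truncating changes nothing on
  short messages.\<close>

lemma aggregates_closed:
  assumes "aggregates g M m" "\<And>x. x \<in># M \<Longrightarrow> P x"
    and "\<And>x y. P x \<Longrightarrow> P y \<Longrightarrow> g x y = f x y \<and> P (f x y)"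
  shows "aggregates f M m \<and> P m"
  using assms(1,2)
proof (induction rule: aggregates.induct)
  case (combine a b M m)
  have "aggregates f (add_mset (g a b) M) m \<and> P m"
    by (rule combine.IH) (use combine.prems assms(3)[of a b] in auto)
  then show ?case using combine.prems assms(3)[of a b] by (auto intro: aggregates.combine)
qed (auto intro: aggregates.single)

lemma aggregates_opt_closed:
  assumes "aggregates_opt g M r" "\<And>x. x \<in># M \<Longrightarrow> P x"
    and "\<And>x y. P x \<Longrightarrow> P y \<Longrightarrow> g x y = f x y \<and> P (f x y)"
  shows "aggregates_opt f M r \<and> (\<forall>m. r = Some m \<longrightarrow> P m)"
proof (cases r)
  case (Some m)
  then have "aggregates g M m" using assms(1) by (simp add: aggregates_opt_def)
  from aggregates_closed[OF this, of P f] assms(2,3) have "aggregates f M m \<and> P m" by blast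
  then show ?thesis using Some by (simp add: aggregates_opt_def)
qed (use assms(1) in \<open>simp add: aggregates_opt_def\<close>)

text \<open>Aggregating with a projection lets an arbitrary one of the messages survive; this is how
  one proposal among many is broadcast.\<close>

lemma aggregates_proj:
  assumes "aggregates (\<lambda>x y. x) M m" shows "m \<in># M"
  using assms by (induction rule: aggregates.induct) auto

text \<open>A host must send a definite message, whereas \<open>aggregates_opt\<close> is a
  relation; any admissible result will do, so one is chosen.\<close>

definition local_agg :: "(msg \<Rightarrow> msg \<Rightarrow> msg) \<Rightarrow> msg multiset \<Rightarrow> msg option" where
  "local_agg f M = (SOME r. aggregates_opt f M r)"

lemma local_agg: "aggregates_opt f M (local_agg f M)"
  unfolding local_agg_def using aggregates_opt_exists by (rule someI_ex)

text \<open>The leader owns the coins of the virtual nodes, so it must not depend on the arbitrary order of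
  aggregation; a minimum does not.\<close>

definition min_id :: "node \<Rightarrow> node \<Rightarrow> node" where
  "min_id x y = (if to_nat x \<le> to_nat y then x else y)"

lemma aggregates_min_id:
  assumes "aggregates min_id M m"
  shows "m \<in># M \<and> (\<forall>x\<in>#M. to_nat m \<le> to_nat x)"
  using assms
  by (induction rule: aggregates.induct) (auto simp: min_id_def split: if_splits)

subsection \<open>Encoding of messages\<close>

definition opt_msg :: "msg option \<Rightarrow> msg" where
  "opt_msg r = (case r of None \<Rightarrow> [] | Some m \<Rightarrow> True # m)"

definition msg_opt :: "msg \<Rightarrow> msg option" where
  "msg_opt m = (case m of [] \<Rightarrow> None | b # m' \<Rightarrow> Some m')"

lemma msg_opt_opt_msg [simp]: "msg_opt (opt_msg r) = r"
  by (simp add: msg_opt_def opt_msg_def split: option.split)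

lemma msg_opt_simps [simp]: "msg_opt [] = None" "msg_opt (b # m) = Some m"
  by (simp_all add: msg_opt_def)

text \<open>In a consensus step every node has to send something. The empty message becomes a
  neutral element standing for no contribution.\<close>

definition lift_op :: "(msg \<Rightarrow> msg \<Rightarrow> msg) \<Rightarrow> msg \<Rightarrow> msg \<Rightarrow> msg" where
  "lift_op f x y = (case msg_opt x of None \<Rightarrow> y | Some a \<Rightarrow>
     (case msg_opt y of None \<Rightarrow> x | Some b \<Rightarrow> True # f a b))"

lemma aggregates_lift_op:
  assumes "aggregates (lift_op f) M m"
  shows "aggregates_opt f (\<Sum>x\<in>#M. mset_opt (msg_opt x)) (msg_opt m)"
  using assms
proof (induction rule: aggregates.induct)
  case (single m)
  then show ?case by (cases "msg_opt m") (auto simp: aggregates_opt_def intro: aggregates.single)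
next
  case (combine a b M m)
  then show ?case
    by (cases "msg_opt a"; cases "msg_opt b"; cases "msg_opt m")
      (auto simp: lift_op_def aggregates_opt_def add_mset_commute intro: aggregates.combine)
qed

text \<open>A self-delimiting code: \<open>True\<close> announces another bit of the first component
  and \<open>False\<close> ends it. Hence the factor 2 in the length, and ultimately the 3 in the
  message bound.\<close>

fun pair_msg :: "msg \<Rightarrow> msg \<Rightarrow> msg" where
  "pair_msg [] y = False # y"
| "pair_msg (b # x) y = True # b # pair_msg x y"

fun msg_pair :: "msg \<Rightarrow> msg \<times> msg" where
  "msg_pair (True # b # m) = (case msg_pair m of (x, y) \<Rightarrow> (b # x, y))"
| "msg_pair m = ([], tl m)"

lemma msg_pair_pair_msg [simp]: "msg_pair (pair_msg x y) = (x, y)"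
  by (induction x) auto

lemma length_pair_msg [simp]: "length (pair_msg x y) = 2 * length x + length y + 1"
  by (induction x) auto

subsection \<open>Minors and rounds\<close>

lemma link_sym: "(x, y) \<in> link F \<longleftrightarrow> (y, x) \<in> link F"
  by (simp add: link_def insert_commute)

lemma rtrancl_link_sym: "(x, y) \<in> (link F)\<^sup>* \<Longrightarrow> (y, x) \<in> (link F)\<^sup>*"
proof -
  have "(link F)\<inverse> = link F" using link_sym by auto
  then show "(x, y) \<in> (link F)\<^sup>* \<Longrightarrow> (y, x) \<in> (link F)\<^sup>*" by (metis rtrancl_converseI)
qed

lemma supernode_of_eq_iff:
  assumes "u \<in> verts G" "v \<in> verts G"
  shows "supernode_of G F u = supernode_of G F v \<longleftrightarrow> (u, v) \<in> (link F)\<^sup>*"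
proof
  assume "supernode_of G F u = supernode_of G F v"
  moreover have "v \<in> supernode_of G F v" using assms by (simp add: supernode_of_def)
  ultimately show "(u, v) \<in> (link F)\<^sup>*" by (auto simp: supernode_of_def)
next
  assume "(u, v) \<in> (link F)\<^sup>*"
  then have "(u, w) \<in> (link F)\<^sup>* \<longleftrightarrow> (v, w) \<in> (link F)\<^sup>*" for w
    by (meson rtrancl_link_sym rtrancl_trans)
  then show "supernode_of G F u = supernode_of G F v" by (simp add: supernode_of_def)
qed

lemma edge_in_minor_iff:
  assumes "simple_graph G" "{a, b} \<in> edges G"
  shows "{a, b} \<in> minor_edges G F \<longleftrightarrow> (a, b) \<notin> (link F)\<^sup>*"
proof -
  have V: "a \<in> verts G" "b \<in> verts G" using assms by (auto simp: simple_graph_def)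
  have "(\<exists>s\<in>supernodes G F. {a, b} \<subseteq> s) \<longleftrightarrow> (a, b) \<in> (link F)\<^sup>*"
  proof
    assume "\<exists>s\<in>supernodes G F. {a, b} \<subseteq> s"
    then obtain v where "(v, a) \<in> (link F)\<^sup>*" "(v, b) \<in> (link F)\<^sup>*"
      by (auto simp: supernodes_def supernode_of_def)
    then show "(a, b) \<in> (link F)\<^sup>*" by (meson rtrancl_link_sym rtrancl_trans)
  next
    assume "(a, b) \<in> (link F)\<^sup>*"
    then show "\<exists>s\<in>supernodes G F. {a, b} \<subseteq> s"
      using V by (auto simp: supernodes_def supernode_of_def)
  qed
  then show ?thesis using assms(2) by (simp only: minor_edges_def mem_Collect_eq simp_thms)
qed

text \<open>Outcomes indexed by nodes and constant on supernodes replace those indexed by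
  supernodes, since the minor changes from round to round while the nodes stay.
  \<open>ma_roundI\<close> is the converse.\<close>

lemma ma_roundE:
  assumes "ma_round A G inp \<omega> t c c'"
  defines "F \<equiv> {e \<in> edges G. contracts A (eview \<omega> c e)}"
  obtains y z where
    "\<And>u v. u \<in> verts G \<Longrightarrow> v \<in> verts G \<Longrightarrow> (u, v) \<in> (link F)\<^sup>* \<Longrightarrow> y u = y v \<and> z u = z v"
    "\<And>v. v \<in> verts G \<Longrightarrow> aggregates (cons_op A t)
       (image_mset (\<lambda>v. cons_value A (nview inp \<omega> c v)) (mset_set (supernode_of G F v))) (y v)"
    "\<And>e. e \<in> edges G \<Longrightarrow> elog c' e =
       elog c e @ [if e \<in> minor_edges G F then (\<lambda>u. (u, y u)) ` e else {}]"
    "\<And>v. v \<in> verts G \<Longrightarrow> aggregates_opt (agg_op A t)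
       (image_mset (\<lambda>(e, u). agg_value A (eview \<omega> c' e) u)
         (mset_set {(e, u). e \<in> minor_edges G F \<and> u \<in> e \<inter> supernode_of G F v})) (z v)"
    "\<And>v. v \<in> verts G \<Longrightarrow> nlog c' v = nlog c v @ [(y v, z v)]"
proof -
  from assms(1) obtain y z where yz:
        "\<forall>s\<in>supernodes G F. aggregates (cons_op A t)
           (image_mset (\<lambda>v. cons_value A (nview inp \<omega> c v)) (mset_set s)) (y s)"
        "\<forall>e\<in>edges G. elog c' e =
           elog c e @ [if e \<in> minor_edges G F then (\<lambda>u. (u, y (supernode_of G F u))) ` e else {}]"
        "\<forall>s\<in>supernodes G F. aggregates_opt (agg_op A t)
           (image_mset (\<lambda>(e, u). agg_value A (eview \<omega> c' e) u)
              (mset_set {(e, u). e \<in> minor_edges G F \<and> u \<in> e \<inter> s})) (z s)"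
        "\<forall>v\<in>verts G. nlog c' v = nlog c v @ [(y (supernode_of G F v), z (supernode_of G F v))]"
    unfolding ma_round_def F_def Let_def by blast
  show thesis
  proof (rule that[of "\<lambda>v. y (supernode_of G F v)" "\<lambda>v. z (supernode_of G F v)"])
    fix u v assume "u \<in> verts G" "v \<in> verts G" "(u, v) \<in> (link F)\<^sup>*"
    then have "supernode_of G F u = supernode_of G F v" by (simp add: supernode_of_eq_iff)
    then show "y (supernode_of G F u) = y (supernode_of G F v) \<and>
        z (supernode_of G F u) = z (supernode_of G F v)" by simp
  qed (use yz in \<open>auto simp: supernodes_def\<close>)
qed

lemma ma_roundI:
  fixes A :: "'i ma_algorithm" and \<omega> c
  assumes "simple_graph G"
  defines "F \<equiv> {e \<in> edges G. contracts A (eview \<omega> c e)}"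
  assumes
    const: "\<And>u v. u \<in> verts G \<Longrightarrow> v \<in> verts G \<Longrightarrow> (u, v) \<in> (link F)\<^sup>* \<Longrightarrow> y u = y v \<and> z u = z v" and
    ya: "\<And>v. v \<in> verts G \<Longrightarrow> aggregates (cons_op A t)
       (image_mset (\<lambda>v. cons_value A (nview inp \<omega> c v)) (mset_set (supernode_of G F v))) (y v)" and
    ea: "\<And>e. e \<in> edges G \<Longrightarrow> elog c' e =
       elog c e @ [if e \<in> minor_edges G F then (\<lambda>u. (u, y u)) ` e else {}]" and
    za: "\<And>v. v \<in> verts G \<Longrightarrow> aggregates_opt (agg_op A t)
       (image_mset (\<lambda>(e, u). agg_value A (eview \<omega> c' e) u)
         (mset_set {(e, u). e \<in> minor_edges G F \<and> u \<in> e \<inter> supernode_of G F v})) (z v)" and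
    na: "\<And>v. v \<in> verts G \<Longrightarrow> nlog c' v = nlog c v @ [(y v, z v)]"
  shows "ma_round A G inp \<omega> t c c'"
proof -
  \<comment> \<open>A representative of every supernode turns outcomes indexed by nodes back into
    outcomes indexed by supernodes; \<open>const\<close> makes the choice immaterial.\<close>
  let ?r = "\<lambda>s. SOME x. x \<in> s"
  have r: "?r (supernode_of G F v) \<in> verts G \<and> (v, ?r (supernode_of G F v)) \<in> (link F)\<^sup>*"
    if "v \<in> verts G" for v
    using someI[of "\<lambda>x. x \<in> supernode_of G F v" v] that by (auto simp: supernode_of_def)
  define y' where "y' = (\<lambda>s. y (?r s))"
  define z' where "z' = (\<lambda>s. z (?r s))"
  have *: "y' (supernode_of G F v) = y v" "z' (supernode_of G F v) = z v" if "v \<in> verts G" for v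
    using const[OF that, of "?r (supernode_of G F v)"] r[OF that] unfolding y'_def z'_def by metis+
  have e: "(\<lambda>u. (u, y' (supernode_of G F u))) ` e = (\<lambda>u. (u, y u)) ` e" if "e \<in> edges G" for e
  proof (rule image_cong[OF refl])
    fix u assume "u \<in> e"
    then have "u \<in> verts G" using that assms(1) by (auto simp: simple_graph_def)
    then show "(u, y' (supernode_of G F u)) = (u, y u)" by (simp add: *)
  qed
  show ?thesis
    unfolding ma_round_def Let_def F_def[symmetric]
    by (intro exI[of _ y'] exI[of _ z'] conjI ballI)
      (auto simp only: supernodes_def image_iff * e ya ea za na)
qed

subsection \<open>The messages of a phase\<close>

text \<open>The lists \<open>virt_ids\<close> may be ordered differently at different nodes; an
  enumeration chosen from the set alone is common to all.\<close>

definition id_list :: "node set \<Rightarrow> node list" where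
  "id_list W = (SOME xs. distinct xs \<and> set xs = W)"

definition id_index :: "node set \<Rightarrow> node \<Rightarrow> nat" where
  "id_index W l = (SOME i. i < card W \<and> id_list W ! i = l)"

lemma id_index:
  assumes "finite W" "l \<in> W"
  shows "id_index W l < card W" "id_list W ! id_index W l = l"
proof -
  have "distinct (id_list W) \<and> set (id_list W) = W"
    unfolding id_list_def by (rule someI_ex) (use finite_distinct_list[OF assms(1)] in blast)
  then have "\<exists>i. i < card W \<and> id_list W ! i = l"
    using assms(2) by (metis distinct_card in_set_conv_nth)
  then have "id_index W l < card W \<and> id_list W ! id_index W l = l"
    unfolding id_index_def by (rule someI_ex)
  then show "id_index W l < card W" "id_list W ! id_index W l = l" by auto
qed

text \<open>Slot 0 belongs to the supernodes without virtual nodes, slot \<open>Suc i\<close> to the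
  label at position \<open>i\<close>.\<close>

definition target :: "node set \<Rightarrow> nat \<Rightarrow> node option" where
  "target W s = (case s of 0 \<Rightarrow> None | Suc i \<Rightarrow> Some (id_list W ! i))"

text \<open>Labels outside \<open>W\<close>, which never occur in a run, get the junk value 0: then the
  position of a slot never leaves the current phase.\<close>

definition slot :: "node set \<Rightarrow> node option \<Rightarrow> nat" where
  "slot W l = (case l of None \<Rightarrow> 0 | Some w \<Rightarrow> if w \<in> W then Suc (id_index W w) else 0)"

lemma slot_le_card: "finite W \<Longrightarrow> slot W l \<le> card W"
  using id_index(1)[of W] by (auto simp: slot_def Suc_le_eq split: option.split)

definition pick :: "'a set \<Rightarrow> 'a option" where
  "pick S = (if S = {} then None else Some (SOME x. x \<in> S))"

lemma pick_in: "pick S = Some x \<Longrightarrow> x \<in> S"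
  by (auto simp: pick_def some_in_eq split: if_splits)

lemma pick_None [simp]: "pick S = None \<longleftrightarrow> S = {}"
  by (simp add: pick_def)

text \<open>Union-find without trees. The shift by 2 skips the election of the leader in round 0 and
  the choice of a virtual node for every part, its bridge, in round 1.\<close>

fun labels :: "(nat \<Rightarrow> msg option) \<Rightarrow> nat \<Rightarrow> node \<Rightarrow> node" where
  "labels ys 0 = id"
| "labels ys (Suc k) = (case ys (k + 2) of None \<Rightarrow> labels ys k
     | Some m \<Rightarrow> (case msg_pair m of (a, b) \<Rightarrow>
        (\<lambda>w. if labels ys k w = labels ys k b then labels ys k a else labels ys k w)))"

text \<open>\<open>ys\<close> is the record of one node, so for a non-virtual \<open>x\<close> the
  value is meaningful only at \<open>x\<close> itself, whose bridge is \<open>ys 1\<close>.\<close>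

definition label_of :: "nat \<Rightarrow> node set \<Rightarrow> (nat \<Rightarrow> msg option) \<Rightarrow> node \<Rightarrow> node option" where
  "label_of \<beta> W ys x = (if x \<in> W then Some (labels ys \<beta> x) else map_option (labels ys \<beta>) (ys 1))"

definition cons_result :: "nat \<Rightarrow> node set \<Rightarrow> (nat \<Rightarrow> msg option) \<Rightarrow> node \<Rightarrow> msg" where
  "cons_result \<beta> W ys x = the (ys (\<beta> + 2 + slot W (label_of \<beta> W ys x)))"

definition agg_result :: "nat \<Rightarrow> node set \<Rightarrow> (nat \<Rightarrow> msg option) \<Rightarrow> node \<Rightarrow> msg option" where
  "agg_result \<beta> W ys x = ys (2 * \<beta> + 4 + slot W (label_of \<beta> W ys x))"

text \<open>Labels alone decide here: a virtual edge has a virtual end point, which is always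
  labelled, so two unlabelled end points never have to be compared.\<close>

definition virt_entry ::
  "nat \<Rightarrow> node set \<Rightarrow> (nat \<Rightarrow> msg option) \<Rightarrow> node set \<Rightarrow> (node \<times> msg) set" where
  "virt_entry \<beta> W ys e = (if \<exists>l. \<forall>x\<in>e. label_of \<beta> W ys x = Some l then {}
     else (\<lambda>x. (x, cons_result \<beta> W ys x)) ` e)"

text \<open>A contracted edge from \<open>u\<close> to \<open>b\<close> also joins \<open>b\<close>
  to the bridge \<open>a\<close> of the part of \<open>u\<close>; thus connections through
  \<open>G\<close> become pairs of virtual nodes.\<close>

definition proposals ::
  "node set \<Rightarrow> node \<Rightarrow> node set set \<Rightarrow> (nat \<Rightarrow> msg option) \<Rightarrow> nat \<Rightarrow> (node \<times> node) set" where
  "proposals W u K ys k = {(a, b). a \<in> W \<and> b \<in> W \<and> labels ys k a \<noteq> labels ys k b \<and>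
     (ys 1 = Some a \<and> {u, b} \<in> K \<or> {a, b} \<in> K)}"

text \<open>The contribution of node \<open>u\<close> to round \<open>j\<close> of a phase, where \<open>ys
  i\<close> is what \<open>u\<close> has learned in round \<open>i\<close>, and \<open>Hn\<close>,
  \<open>He\<close>, \<open>K\<close> are the nodes, the virtual edges and the contracted virtual edges run by
  \<open>u\<close>. Round 0 elects the leader, round 1 finds a virtual node for every part, and the next
  \<open>\<beta>\<close> rounds merge labels. Then come \<open>1 + \<beta>\<close> rounds of consensus, for
  the parts without virtual nodes and for each label; one round without contraction in which the edges of
  \<open>G\<close> learn labels and consensus values and every node gets the aggregate \<open>zx\<close> of
  its own edges; and \<open>1 + \<beta>\<close> rounds of aggregation.\<close>

definition sub_msg ::
  "nat \<Rightarrow> node set \<Rightarrow> node \<Rightarrow> node set \<Rightarrow> node set set \<Rightarrow> node set set \<Rightarrow> (node \<Rightarrow> msg) \<Rightarrow>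
   (node set \<Rightarrow> (node \<times> msg) set \<Rightarrow> node \<Rightarrow> msg) \<Rightarrow> (msg \<Rightarrow> msg \<Rightarrow> msg) \<Rightarrow> (msg \<Rightarrow> msg \<Rightarrow> msg) \<Rightarrow>
   (nat \<Rightarrow> msg option) \<Rightarrow> msg option \<Rightarrow> nat \<Rightarrow> msg option" where
  "sub_msg \<beta> W u Hn He K x a fc fa ys zx j =
    (if j = 0 then Some u
     else if j = 1 then pick {w \<in> W. {u, w} \<in> K}
     else if j < \<beta> + 2 then map_option (\<lambda>(a, b). pair_msg a b) (pick (proposals W u K ys (j - 2)))
     else if j < 2 * \<beta> + 3 then local_agg fc
       (image_mset x (mset_set {w \<in> Hn. label_of \<beta> W ys w = target W (j - (\<beta> + 2))}))
     else if j = 2 * \<beta> + 3 then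
       Some (pair_msg (opt_msg (label_of \<beta> W ys u)) (cons_result \<beta> W ys u))
     else local_agg fa
       (mset_opt (if label_of \<beta> W ys u = target W (j - (2 * \<beta> + 4)) then zx else None) +
        image_mset (\<lambda>(e, w). a e (virt_entry \<beta> W ys e) w)
          (mset_set {(e, w). e \<in> He \<and> virt_entry \<beta> W ys e \<noteq> {} \<and> w \<in> e \<and>
             label_of \<beta> W ys w = target W (j - (2 * \<beta> + 4))})))"

definition sub_op ::
  "nat \<Rightarrow> (msg \<Rightarrow> msg \<Rightarrow> msg) \<Rightarrow> (msg \<Rightarrow> msg \<Rightarrow> msg) \<Rightarrow> nat \<Rightarrow> msg \<Rightarrow> msg \<Rightarrow> msg" where
  "sub_op \<beta> fc fa j = (if j = 0 then min_id else if j < \<beta> + 2 then (\<lambda>x y. x)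
     else if j < 2 * \<beta> + 3 then fc else fa)"

definition hosted_nodes :: "graph \<Rightarrow> graph \<Rightarrow> node \<Rightarrow> node \<Rightarrow> node set" where
  "hosted_nodes G Gv ldr u = insert u (if u = ldr then virtual_nodes G Gv else {})"

definition hosted_edges :: "graph \<Rightarrow> graph \<Rightarrow> node \<Rightarrow> node \<Rightarrow> node set set" where
  "hosted_edges G Gv ldr u = {e \<in> virtual_edges G Gv. u \<in> e} \<union>
     (if u = ldr then {e \<in> virtual_edges G Gv. e \<subseteq> virtual_nodes G Gv} else {})"

lemma image_mset_set_cong: "(\<And>p. p \<in> S \<Longrightarrow> f p = g p) \<Longrightarrow> image_mset f (mset_set S) =
  image_mset g (mset_set S)"
  by (cases "finite S") (auto intro: image_mset_cong)

lemma sum_mset_set_UNION: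
  assumes "finite S" "\<And>v. v \<in> S \<Longrightarrow> finite (T v)"
    and "\<And>u v. u \<in> S \<Longrightarrow> v \<in> S \<Longrightarrow> u \<noteq> v \<Longrightarrow> T u \<inter> T v = {}"
  shows "(\<Sum>v\<in>S. image_mset g (mset_set (T v))) = image_mset g (mset_set (\<Union>v\<in>S. T v))"
  using assms
proof (induction S rule: finite_induct)
  case (insert v S)
  have "T v \<inter> (\<Union>v\<in>S. T v) = {}" using insert.prems(2) insert.hyps(2) by fastforce
  then show ?case using insert by (simp add: mset_set_Union)
qed simp

lemma sum_mset_opt_in:
  "x \<in># (\<Sum>v\<in>S. mset_opt (g v)) \<Longrightarrow> \<exists>v\<in>S. g v = Some x"
proof (induction S rule: infinite_finite_induct)
  case (insert v S)
  then show ?case by (cases "g v") auto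
qed auto

lemma sum_mset_opt_empty:
  "finite S \<Longrightarrow> (\<Sum>v\<in>S. mset_opt (g v)) = {#} \<longleftrightarrow> (\<forall>v\<in>S. g v = None)"
  by (induction S rule: finite_induct) (auto simp: mset_opt_def split: option.splits)

subsection \<open>Correctness of a phase\<close>

locale virt_ext =
  fixes G Gv :: graph and ldr :: node
  assumes G: "simple_graph G" and Gv: "virtual_graph G Gv" and ldr_in: "ldr \<in> verts G"
begin

definition "W = virtual_nodes G Gv"
definition "V = verts G"

lemma ldr: "ldr \<in> V" using ldr_in by (simp add: V_def)
lemma simple_Gv: "simple_graph Gv" using Gv by (simp add: virtual_graph_def)
lemma finite_Gv: "finite (verts Gv)" using simple_Gv by (simp add: simple_graph_def)
lemma verts_Gv: "verts Gv = V \<union> W" "V \<inter> W = {}"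
  using Gv by (auto simp: virtual_graph_def W_def V_def virtual_nodes_def)
lemma finite_V: "finite V" and finite_W: "finite W"
  using finite_Gv verts_Gv by auto
lemma edges_sub: "edges G \<subseteq> edges Gv" using Gv by (simp add: virtual_graph_def)
lemma finite_edges: "finite (edges Gv)"
  using simple_Gv by (intro finite_subset[of "edges Gv" "Pow (verts Gv)"])
    (auto simp: simple_graph_def)

lemma edge_cases:
  assumes "e \<in> edges Gv"
  obtains (real) u v where "e = {u, v}" "u \<in> V" "v \<in> V" "u \<noteq> v" "e \<in> edges G"
  | (mixed) u w where "e = {u, w}" "u \<in> V" "w \<in> W" "e \<in> virtual_edges G Gv"
  | (virt) w w' where "e = {w, w'}" "w \<in> W" "w' \<in> W" "w \<noteq> w'" "e \<in> virtual_edges G Gv"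
proof -
  have "card e = 2" "e \<subseteq> V \<union> W" using assms simple_Gv verts_Gv by (auto simp: simple_graph_def)
  then obtain p q where e: "e = {p, q}" "p \<noteq> q" by (auto simp: card_2_iff)
  show thesis
  proof (cases "e \<in> edges G")
    case True
    then have "e \<subseteq> V" using G by (auto simp: simple_graph_def V_def)
    then show ?thesis using e True real by auto
  next
    case False
    then have v: "e \<in> virtual_edges G Gv" using assms by (simp add: virtual_edges_def)
    then have "p \<in> W \<or> q \<in> W" using Gv e by (auto simp: virtual_graph_def W_def)
    then show ?thesis using e v \<open>e \<subseteq> V \<union> W\<close> mixed[of p q] mixed[of q p] virt[of p q]
      by (auto simp: insert_commute)
  qed
qed

lemma VV_edge_real: "{u, v} \<in> edges Gv \<Longrightarrow> u \<in> V \<Longrightarrow> v \<in> V \<Longrightarrow> {u, v} \<in> edges G"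
  by (erule edge_cases) (use verts_Gv(2) in \<open>auto simp: doubleton_eq_iff\<close>)

lemma VW_edge_hosted: "{u, w} \<in> edges Gv \<Longrightarrow> u \<in> V \<Longrightarrow> w \<in> W \<Longrightarrow> {u, w} \<in> hosted_edges G Gv ldr u"
  by (erule edge_cases) (use verts_Gv(2) in \<open>auto simp: doubleton_eq_iff hosted_edges_def\<close>)

lemma WW_edge_hosted: "{w, w'} \<in> edges Gv \<Longrightarrow> w \<in> W \<Longrightarrow> w' \<in> W \<Longrightarrow> {w, w'} \<in> hosted_edges G Gv ldr ldr"
  by (erule edge_cases) (use verts_Gv(2) in \<open>auto simp: doubleton_eq_iff hosted_edges_def W_def\<close>)

lemma hosted_edge_sub: "e \<in> hosted_edges G Gv ldr u \<Longrightarrow> u \<in> V \<Longrightarrow>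
    e \<in> virtual_edges G Gv \<and> e \<in> edges Gv \<and> e \<subseteq> insert u W"
proof -
  assume e: "e \<in> hosted_edges G Gv ldr u" and u: "u \<in> V"
  then have *: "e \<in> edges Gv" "e \<in> virtual_edges G Gv"
    by (auto simp: hosted_edges_def virtual_edges_def split: if_splits)
  show ?thesis using *(1)
    by (cases rule: edge_cases)
      (use * e u verts_Gv(2) in \<open>auto simp: hosted_edges_def virtual_edges_def W_def split:
        if_splits\<close>)
qed

text \<open>An edge run by both nodes would contain neither of them, and only the leader runs edges
  that it is not an end point of.\<close>

lemma hosted_edges_disjoint:
  "u \<in> V \<Longrightarrow> v \<in> V \<Longrightarrow> u \<noteq> v \<Longrightarrow> hosted_edges G Gv ldr u \<inter> hosted_edges G Gv ldr v = {}"
proof (rule ccontr)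
  assume uv: "u \<in> V" "v \<in> V" "u \<noteq> v" "hosted_edges G Gv ldr u \<inter> hosted_edges G Gv ldr v \<noteq> {}"
  then obtain e where e: "e \<in> hosted_edges G Gv ldr u" "e \<in> hosted_edges G Gv ldr v" by auto
  then have "e \<subseteq> insert u W" "e \<subseteq> insert v W" using hosted_edge_sub uv by blast+
  then have "e \<subseteq> W" using uv(3) by blast
  then have "u \<notin> e" "v \<notin> e" using uv verts_Gv(2) by auto
  then show False using e uv(3) by (auto simp: hosted_edges_def split: if_splits)
qed

end

definition phase_msg where
  "phase_msg G Gv ldr \<beta> Fv x ag fc fa Y Zx u j =
     sub_msg \<beta> (virtual_nodes G Gv) u (hosted_nodes G Gv ldr u) (hosted_edges G Gv ldr u)
      (Fv \<inter> hosted_edges G Gv ldr u) x ag fc fa (Y u) (Zx u) j"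

text \<open>The rounds enter only through two guarantees: outcomes are constant on supernodes, and
  they are aggregates of the contributions. That \<open>Y\<close> occurs in the contributions as
  well is no circle, because a message depends on earlier rounds only
  (\<open>sub_msg_cong\<close>).\<close>

locale phase = virt_ext +
  fixes \<beta> :: nat and Fv :: "node set set" and x :: "node \<Rightarrow> msg"
    and ag :: "node set \<Rightarrow> (node \<times> msg) set \<Rightarrow> node \<Rightarrow> msg"
    and fc fa :: "msg \<Rightarrow> msg \<Rightarrow> msg"
    and Y :: "node \<Rightarrow> nat \<Rightarrow> msg option" and Zx :: "node \<Rightarrow> msg option"
  assumes card_virt: "card (virtual_nodes G Gv) \<le> \<beta>" and Fv: "Fv \<subseteq> edges Gv"
    and part_const0: "\<And>j u v. j \<in> {1, \<beta> + 2, 2 * \<beta> + 4} \<Longrightarrow> u \<in> verts G \<Longrightarrow> v \<in> verts G \<Longrightarrow>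
      (u, v) \<in> (link (Fv \<inter> edges G))\<^sup>* \<Longrightarrow> Y u j = Y v j"
    and part_agg0: "\<And>j u. j \<in> {1, \<beta> + 2, 2 * \<beta> + 4} \<Longrightarrow> u \<in> verts G \<Longrightarrow>
      aggregates_opt (sub_op \<beta> fc fa j) (\<Sum>v\<in>supernode_of G (Fv \<inter> edges G) u.
        mset_opt (phase_msg G Gv ldr \<beta> Fv x ag fc fa Y Zx v j)) (Y u j)"
    and full_const0: "\<And>j u v. j < 3 * \<beta> + 5 \<Longrightarrow> j \<notin> {1, \<beta> + 2, 2 * \<beta> + 3, 2 * \<beta> + 4} \<Longrightarrow>
      u \<in> verts G \<Longrightarrow> v \<in> verts G \<Longrightarrow> Y u j = Y v j"
    and full_agg0: "\<And>j u. j < 3 * \<beta> + 5 \<Longrightarrow> j \<notin> {1, \<beta> + 2, 2 * \<beta> + 3, 2 * \<beta> + 4} \<Longrightarrow>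
      u \<in> verts G \<Longrightarrow> aggregates_opt (sub_op \<beta> fc fa j)
        (\<Sum>v\<in>verts G. mset_opt (phase_msg G Gv ldr \<beta> Fv x ag fc fa Y Zx v j)) (Y u j)"
begin

definition "F = Fv \<inter> edges G"

definition "N u j = phase_msg G Gv ldr \<beta> Fv x ag fc fa Y Zx u j"

lemma N_eq: "N u j = sub_msg \<beta> W u (hosted_nodes G Gv ldr u) (hosted_edges G Gv ldr u)
      (Fv \<inter> hosted_edges G Gv ldr u) x ag fc fa (Y u) (Zx u) j"
  by (simp add: N_def phase_msg_def W_def)

lemmas card_W = card_virt[folded W_def]
lemmas part_const = part_const0[folded V_def F_def]
lemmas part_agg = part_agg0[folded V_def F_def N_def]
lemmas full_const = full_const0[folded V_def]
lemmas full_agg = full_agg0[folded V_def N_def]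

lemma link_F: "link F \<subseteq> link Fv" by (auto simp: link_def F_def)
lemma rtrancl_F: "(p, q) \<in> (link F)\<^sup>* \<Longrightarrow> (p, q) \<in> (link Fv)\<^sup>*"
  using rtrancl_mono[OF link_F] by auto

lemma link_Fv_verts: "(p, q) \<in> link Fv \<Longrightarrow> p \<in> verts Gv \<and> q \<in> verts Gv"
  using Fv simple_Gv by (fastforce simp: link_def simple_graph_def)

section \<open>Merging the labels of the virtual nodes\<close>

definition L :: "nat \<Rightarrow> node \<Rightarrow> node" where "L k = labels (Y ldr) k"

lemma labels_eq:
  assumes "u \<in> V" "k \<le> \<beta>" shows "labels (Y u) k = L k"
  using assms(2)
proof (induction k)
  case (Suc k)
  have "Y u (k + 2) = Y ldr (k + 2)"
    by (rule full_const) (use Suc.prems assms ldr in auto)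
  moreover have "labels (Y u) k = L k" using Suc by simp
  ultimately show ?case unfolding L_def labels.simps by metis
qed (simp add: L_def)

lemma bridge_Some:
  assumes "u \<in> V" "Y u 1 = Some r"
  shows "r \<in> W \<and> (u, r) \<in> (link Fv)\<^sup>*"
proof -
  have "aggregates (\<lambda>x y. x) (\<Sum>v\<in>supernode_of G F u. mset_opt (N v 1)) r"
    using part_agg[of 1 u] assms by (simp add: sub_op_def aggregates_opt_def)
  then obtain v where v: "v \<in> supernode_of G F u" "N v 1 = Some r"
    using aggregates_proj sum_mset_opt_in by fast
  then have "r \<in> W" "{v, r} \<in> Fv" by (auto simp: N_eq sub_msg_def dest!: pick_in)
  moreover have "(u, v) \<in> (link Fv)\<^sup>*" using v by (auto simp: supernode_of_def intro: rtrancl_F)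
  ultimately show ?thesis by (auto simp: link_def intro: rtrancl_into_rtrancl)
qed

text \<open>\<open>u\<close> itself nominates a virtual node in round 1, so the contributions of its
  part are not empty.\<close>

lemma bridge_None:
  assumes "u \<in> V" "w \<in> W" "{u, w} \<in> Fv"
  shows "Y u 1 \<noteq> None"
proof
  assume "Y u 1 = None"
  then have "(\<Sum>v\<in>supernode_of G F u. mset_opt (N v 1)) = {#}"
    using part_agg[of 1 u] assms by (simp add: aggregates_opt_def)
  moreover have "finite (supernode_of G F u)" using finite_V by (simp add: supernode_of_def V_def)
  moreover have "u \<in> supernode_of G F u" using assms by (simp add: supernode_of_def V_def)
  ultimately have "N u 1 = None" by (metis sum_mset_opt_empty)
  then show False using assms VW_edge_hosted Fv by (auto simp: N_eq sub_msg_def)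
qed

definition props :: "node \<Rightarrow> nat \<Rightarrow> (node \<times> node) set" where
  "props u k = proposals W u (Fv \<inter> hosted_edges G Gv ldr u) (Y u) k"

lemma props_connected:
  assumes "u \<in> V" "(a, b) \<in> props u k" "k \<le> \<beta>"
  shows "a \<in> W \<and> b \<in> W \<and> (a, b) \<in> (link Fv)\<^sup>* \<and> L k a \<noteq> L k b"
proof -
  have *: "a \<in> W" "b \<in> W" "L k a \<noteq> L k b" "Y u 1 = Some a \<and> {u, b} \<in> Fv \<or> {a, b} \<in> Fv"
    using assms by (auto simp: props_def proposals_def labels_eq)
  from *(4) show ?thesis
  proof
    assume "Y u 1 = Some a \<and> {u, b} \<in> Fv"
    with bridge_Some[OF assms(1), of a] have "a \<in> W" "(u, a) \<in> (link Fv)\<^sup>*" "(u, b) \<in> link Fv"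
      by (auto simp: link_def)
    then show ?thesis using * by (meson r_into_rtrancl rtrancl_link_sym rtrancl_trans)
  next
    assume "{a, b} \<in> Fv"
    then show ?thesis using * by (auto simp: link_def)
  qed
qed

definition stable :: "nat \<Rightarrow> bool" where
  "stable k \<longleftrightarrow> (\<forall>u\<in>V. props u k = {})"

text \<open>No outcome means that nobody proposed anything; otherwise the surviving message is a
  genuine proposal of some node.\<close>

lemma merge_step:
  assumes "k < \<beta>"
  shows "(stable k \<and> L (Suc k) = L k) \<or> (\<exists>u\<in>V. \<exists>a b. (a, b) \<in> props u k \<and>
     L (Suc k) = (\<lambda>w. if L k w = L k b then L k a else L k w))"
proof -
  have ag: "aggregates_opt (\<lambda>x y. x) (\<Sum>v\<in>V. mset_opt (N v (k + 2))) (Y ldr (k + 2))"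
    using full_agg[of "k + 2" ldr] assms ldr by (simp add: sub_op_def)
  have Nv: "N v (k + 2) = map_option (\<lambda>(a, b). pair_msg a b) (pick (props v k))" for v
    using assms by (simp add: N_eq sub_msg_def props_def)
  show ?thesis
  proof (cases "Y ldr (k + 2)")
    case None
    then have "\<forall>v\<in>V. N v (k + 2) = None"
      using ag sum_mset_opt_empty[OF finite_V, of "\<lambda>v. N v (k + 2)"]
        by (simp add: aggregates_opt_def)
    then have "stable k" unfolding stable_def Nv by simp
    then show ?thesis using None by (simp add: L_def)
  next
    case (Some m)
    then have "m \<in># (\<Sum>v\<in>V. mset_opt (N v (k + 2)))"
      using ag aggregates_proj by (simp add: aggregates_opt_def)
    then obtain v where v: "v \<in> V" "N v (k + 2) = Some m" using sum_mset_opt_in by fast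
    then obtain a b where "(a, b) \<in> props v k" "m = pair_msg a b"
      unfolding Nv by (auto dest: pick_in)
    then show ?thesis using v Some by (intro disjI2 bexI[of _ v] exI[of _ a] exI[of _ b])
      (auto simp: L_def)
  qed
qed

text \<open>Soundness of merging: only connected pairs are ever proposed, so a label never leaves
  the component.\<close>

lemma L_connected:
  assumes "w \<in> W" "k \<le> \<beta>"
  shows "L k w \<in> W \<and> (w, L k w) \<in> (link Fv)\<^sup>*"
  using assms(2,1)
proof (induction k arbitrary: w)
  case (Suc k)
  consider "L (Suc k) = L k" | u a b where "u \<in> V" "(a, b) \<in> props u k"
    "L (Suc k) = (\<lambda>w. if L k w = L k b then L k a else L k w)"
    using merge_step[of k] Suc.prems by auto
  then show ?case
  proof cases
    case 2
    then have ab: "a \<in> W" "b \<in> W" "(a, b) \<in> (link Fv)\<^sup>*" using props_connected Suc.prems by auto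
    then show ?thesis using 2(3) Suc.IH[of w] Suc.IH[of a] Suc.IH[of b] Suc.prems
      by (auto, metis rtrancl_link_sym rtrancl_trans)
  qed (use Suc in auto)
qed (simp add: L_def)

text \<open>Each effective merge destroys a label for good, and a stable state persists because
  proposals depend on the round only through the labels.\<close>

lemma stable_or_few:
  assumes "k \<le> \<beta>" shows "stable k \<or> card (L k ` W) + k \<le> card W"
  using assms
proof (induction k)
  case (Suc k)
  show ?case
  proof (cases "stable k \<and> L (Suc k) = L k")
    case True
    then have "props u (Suc k) = props u k" if "u \<in> V" for u
      using that Suc.prems labels_eq[of u "Suc k"] labels_eq[of u k] True
      unfolding props_def proposals_def by (simp del: labels.simps)
    then show ?thesis using True by (simp add: stable_def)
  next
    case False
    then obtain u a b where ab: "u \<in> V" "(a, b) \<in> props u k"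
      "L (Suc k) = (\<lambda>w. if L k w = L k b then L k a else L k w)"
      using merge_step[of k] Suc.prems by auto
    then have abW: "a \<in> W" "b \<in> W" "L k a \<noteq> L k b" using props_connected Suc.prems by auto
    \<comment> \<open>The label of \<open>a\<close> survives, so the new labels are old ones, and
      that of \<open>b\<close> is gone.\<close>
    then have "L (Suc k) ` W \<subseteq> L k ` W - {L k b}" using ab by auto
    then have "card (L (Suc k) ` W) < card (L k ` W)"
      using finite_W abW by (intro psubset_card_mono) auto
    moreover have "\<not> stable k" using ab by (auto simp: stable_def)
    ultimately show ?thesis using Suc by auto
  qed
qed (auto simp: card_image_le finite_W)

text \<open>With at most \<beta> virtual nodes, \<beta> effective merges would leave no label at
  all; then \<open>W\<close> is empty and nothing can be proposed.\<close>

lemma stable_final: "stable \<beta>"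
proof (rule ccontr)
  assume "\<not> stable \<beta>"
  with stable_or_few[of \<beta>] card_W have "card (L \<beta> ` W) = 0" by auto
  then have "W = {}" using finite_W by simp
  then show False using \<open>\<not> stable \<beta>\<close> by (auto simp: stable_def props_def proposals_def)
qed

section \<open>Labels characterise the supernodes of the virtual graph\<close>

definition Lam :: "node \<Rightarrow> node option" where
  "Lam w = (if w \<in> W then Some (L \<beta> w) else map_option (L \<beta>) (Y w 1))"

text \<open>\<open>Lam\<close> is the label seen from outside, through the logs of all nodes; every
  node computes it correctly for itself and for the virtual nodes.\<close>

lemma label_of_eq: "u \<in> V \<Longrightarrow> w \<in> insert u W \<Longrightarrow> label_of \<beta> W (Y u) w = Lam w"
  using verts_Gv(2) by (auto simp: label_of_def Lam_def labels_eq)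

lemma Lam_link: "(p, q) \<in> link Fv \<Longrightarrow> Lam p = Lam q"
proof -
  have VW: "Lam u = Lam w" if uw: "u \<in> V" "w \<in> W" "{u, w} \<in> Fv" for u w
  proof -
    obtain a where a: "Y u 1 = Some a" using bridge_None[OF uw] by blast
    \<comment> \<open>If the bridge \<open>a\<close> of \<open>u\<close> and its neighbour
      \<open>w\<close> had different labels, they would be a proposal of \<open>u\<close>.\<close>
    have "(a, w) \<notin> props u \<beta>" using stable_final that by (auto simp: stable_def)
    then have "L \<beta> a = L \<beta> w" using that a VW_edge_hosted Fv bridge_Some[OF uw(1) a]
      by (auto simp: props_def proposals_def labels_eq)
    then show ?thesis using a that verts_Gv(2) by (auto simp: Lam_def)
  qed
  assume pq: "(p, q) \<in> link Fv"
  then have e: "{p, q} \<in> Fv" "{p, q} \<in> edges Gv" using Fv by (auto simp: link_def)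
  have "p \<in> V \<union> W" "q \<in> V \<union> W" using link_Fv_verts[OF pq] verts_Gv by auto
  then consider "p \<in> V" "q \<in> V" | "p \<in> V" "q \<in> W" | "p \<in> W" "q \<in> V" | "p \<in> W" "q \<in> W" by auto
  then show ?thesis
  proof cases
    case 1
    then have "(p, q) \<in> link F" using e VV_edge_real by (auto simp: F_def link_def)
    then have "Y p 1 = Y q 1" using part_const[of 1 p q] 1 by auto
    then show ?thesis using 1 verts_Gv(2) by (auto simp: Lam_def)
  next
    case 4
    have "(p, q) \<notin> props ldr \<beta>" using stable_final ldr by (auto simp: stable_def)
    then have "L \<beta> p = L \<beta> q" using 4 e ldr WW_edge_hosted
      by (auto simp: props_def proposals_def labels_eq)
    then show ?thesis using 4 by (simp add: Lam_def)
  qed (use VW e in \<open>auto simp: insert_commute\<close>)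
qed

lemma Lam_const: "(p, q) \<in> (link Fv)\<^sup>* \<Longrightarrow> Lam p = Lam q"
  by (induction rule: rtrancl_induct) (auto dest: Lam_link)

text \<open>Since a label is itself a virtual node of the component, equal labels force a common
  supernode.\<close>

lemma Lam_rep:
  assumes "p \<in> verts Gv" "Lam p = Some l"
  shows "l \<in> W \<and> (p, l) \<in> (link Fv)\<^sup>*"
proof (cases "p \<in> W")
  case True
  then show ?thesis using assms L_connected[of p \<beta>] by (auto simp: Lam_def)
next
  case False
  then obtain r where r: "Y p 1 = Some r" "l = L \<beta> r" using assms by (auto simp: Lam_def)
  have "p \<in> V" using False assms verts_Gv by auto
  from bridge_Some[OF this r(1)] show ?thesis using L_connected[of r \<beta>] r
    by (auto intro: rtrancl_trans)
qed

text \<open>A path from an unlabelled node stays unlabelled, hence never meets a virtual node and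
  uses edges of \<open>G\<close> only.\<close>

lemma connected_None:
  assumes "(p, q) \<in> (link Fv)\<^sup>*" "p \<in> V" "Lam p = None"
  shows "q \<in> V \<and> (p, q) \<in> (link F)\<^sup>*"
  using assms(1)
proof (induction rule: rtrancl_induct)
  case (step q r)
  have "Lam r = None" using step assms Lam_const Lam_link by metis
  then have "r \<in> V" using link_Fv_verts[OF step(2)] verts_Gv
    by (auto simp: Lam_def split: if_splits)
  then have "(q, r) \<in> link F" using step Fv VV_edge_real by (auto simp: link_def F_def)
  then show ?case using \<open>r \<in> V\<close> step by (auto intro: rtrancl_into_rtrancl)
qed (use assms in auto)

text \<open>Replaces connectivity in the virtual graph by data available on \<open>G\<close>: the
  label, and for unlabelled nodes the part.\<close>

lemma connected_iff:
  assumes "p \<in> verts Gv" "q \<in> verts Gv"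
  shows "(p, q) \<in> (link Fv)\<^sup>* \<longleftrightarrow> Lam p = Lam q \<and> (Lam p = None \<longrightarrow> (p, q) \<in> (link F)\<^sup>*)"
proof
  assume *: "(p, q) \<in> (link Fv)\<^sup>*"
  have "p \<in> V" if "Lam p = None" using that assms verts_Gv by (auto simp: Lam_def split: if_splits)
  then show "Lam p = Lam q \<and> (Lam p = None \<longrightarrow> (p, q) \<in> (link F)\<^sup>*)"
    using * Lam_const connected_None by auto
next
  assume *: "Lam p = Lam q \<and> (Lam p = None \<longrightarrow> (p, q) \<in> (link F)\<^sup>*)"
  show "(p, q) \<in> (link Fv)\<^sup>*"
  proof (cases "Lam p")
    case None
    then show ?thesis using * rtrancl_F by auto
  next
    case (Some l)
    then show ?thesis using * Lam_rep assms by (metis rtrancl_link_sym rtrancl_trans)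
  qed
qed

section \<open>Outcomes of the supernodes of the virtual graph\<close>

definition y :: "node \<Rightarrow> msg" where
  "y w = the (Y (if w \<in> W then ldr else w) (\<beta> + 2 + slot W (Lam w)))"

definition z :: "node \<Rightarrow> msg option" where
  "z w = Y (if w \<in> W then ldr else w) (2 * \<beta> + 4 + slot W (Lam w))"

lemma target_slot: "w \<in> verts Gv \<Longrightarrow> target W (slot W (Lam w)) = Lam w"
  using Lam_rep[of w] id_index(2)[OF finite_W]
  by (cases "Lam w") (auto simp: target_def slot_def)

lemma slot_le: "w \<in> verts Gv \<Longrightarrow> slot W (Lam w) \<le> \<beta>"
  using slot_le_card[OF finite_W] card_W by (rule order_trans)

text \<open>Slot 0 is served with the parts contracted, every positive slot with all of
  \<open>G\<close> contracted. So a virtual node, which has no log on \<open>G\<close>, may have its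
  outcome read off at the leader.\<close>

lemma slot_round_const:
  assumes "p \<in> V" "q \<in> V" "w \<in> verts Gv" "d \<in> {\<beta> + 2, 2 * \<beta> + 4}"
    and "Lam w = None \<longrightarrow> (p, q) \<in> (link F)\<^sup>*"
  shows "Y p (d + slot W (Lam w)) = Y q (d + slot W (Lam w))"
proof (cases "Lam w")
  case None
  then show ?thesis using part_const[of d p q] assms by (auto simp: slot_def)
next
  case (Some l)
  have "slot W (Lam w) \<le> \<beta>" "slot W (Lam w) > 0"
    using slot_le[OF assms(3)] Some Lam_rep[OF assms(3) Some] by (auto simp: slot_def)
  then show ?thesis by (intro full_const) (use assms in auto)
qed

lemma cons_result_eq:
  assumes "u \<in> V" "w \<in> insert u W" shows "cons_result \<beta> W (Y u) w = y w"
proof -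
  have w: "w \<in> verts Gv" "Lam w = None \<Longrightarrow> w = u"
    using assms verts_Gv by (auto simp: Lam_def split: if_splits)
  show ?thesis
    using slot_round_const[of u "if w \<in> W then ldr else w" w "\<beta> + 2"] assms w ldr verts_Gv(2)
    by (auto simp: cons_result_def y_def label_of_eq Lam_def split: if_splits)
qed

lemma agg_result_eq:
  assumes "u \<in> V" "w \<in> insert u W" shows "agg_result \<beta> W (Y u) w = z w"
proof -
  have w: "w \<in> verts Gv" "Lam w = None \<Longrightarrow> w = u"
    using assms verts_Gv by (auto simp: Lam_def split: if_splits)
  show ?thesis
    using slot_round_const[of u "if w \<in> W then ldr else w" w "2 * \<beta> + 4"] assms w ldr verts_Gv(2)
    by (auto simp: agg_result_def z_def label_of_eq Lam_def split: if_splits)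
qed

definition ent :: "node set \<Rightarrow> (node \<times> msg) set" where
  "ent e = (if e \<in> minor_edges Gv Fv then (\<lambda>w. (w, y w)) ` e else {})"

lemma minor_iff:
  assumes "{p, q} \<in> edges Gv"
  shows "{p, q} \<in> minor_edges Gv Fv \<longleftrightarrow> Lam p \<noteq> Lam q \<or> Lam p = None \<and> (p, q) \<notin> (link F)\<^sup>*"
proof -
  have "p \<in> verts Gv" "q \<in> verts Gv" using assms simple_Gv by (auto simp: simple_graph_def)
  then show ?thesis using edge_in_minor_iff[OF simple_Gv assms] connected_iff[of p q] by auto
qed

lemma virt_entry_eq:
  assumes "u \<in> V" "e \<in> edges Gv" "e \<in> virtual_edges G Gv" "e \<subseteq> insert u W"
  shows "virt_entry \<beta> W (Y u) e = ent e"
proof -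
  have im: "(\<lambda>w. (w, cons_result \<beta> W (Y u) w)) ` e = (\<lambda>w. (w, y w)) ` e"
    using assms cons_result_eq by (intro image_cong) auto
  have lb: "label_of \<beta> W (Y u) w = Lam w" if "w \<in> e" for w
    using that assms label_of_eq by auto
  from assms(2) have "e \<in> minor_edges Gv Fv \<longleftrightarrow> \<not> (\<exists>l. \<forall>w\<in>e. Lam w = Some l)"
  proof (cases rule: edge_cases)
    case (real u v)
    then show ?thesis using assms by (auto simp: virtual_edges_def)
  next
    case (mixed u w)
    then show ?thesis using minor_iff[of u w] assms(2) by (auto simp: Lam_def)
  next
    case (virt w w')
    then show ?thesis using minor_iff[of w w'] assms(2) by (auto simp: Lam_def)
  qed
  then show ?thesis using im lb unfolding virt_entry_def ent_def by (metis (no_types, lifting))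
qed

text \<open>Both end points of an edge of \<open>G\<close> may be unlabelled, where labels decide
  nothing; the minor of \<open>G\<close> by the parts settles that case.\<close>

definition entG :: "node set \<Rightarrow> (node \<times> msg) set" where
  "entG e = (if e \<in> minor_edges G F \<and> \<not> (\<exists>l. \<forall>w\<in>e. label_of \<beta> W (Y w) w = Some l)
       then (\<lambda>w. (w, cons_result \<beta> W (Y w) w)) ` e else {})"

lemma entG_eq:
  assumes "e \<in> edges G" shows "entG e = ent e"
proof -
  from assms G obtain p q where e: "e = {p, q}" "p \<in> V" "q \<in> V"
    by (auto simp: simple_graph_def V_def card_2_iff)
  have im: "(\<lambda>w. (w, cons_result \<beta> W (Y w) w)) ` e = (\<lambda>w. (w, y w)) ` e"
    using e cons_result_eq by (intro image_cong) auto
  have "{p, q} \<in> edges Gv" using e assms edges_sub by auto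
  from minor_iff[OF this] edge_in_minor_iff[OF G, of p q F] e assms
  have "e \<in> minor_edges Gv Fv \<longleftrightarrow>
    e \<in> minor_edges G F \<and> \<not> (\<exists>l. \<forall>w\<in>e. label_of \<beta> W (Y w) w = Some l)"
    using connected_iff[of p q] verts_Gv rtrancl_F Lam_const by (auto simp: label_of_eq)
  then show ?thesis using im unfolding entG_def ent_def by presburger
qed

lemma yz_const:
  assumes "p \<in> verts Gv" "q \<in> verts Gv" "(p, q) \<in> (link Fv)\<^sup>*"
  shows "y p = y q \<and> z p = z q"
proof -
  let ?h = "\<lambda>w. if w \<in> W then ldr else w"
  have h: "?h p \<in> V" "?h q \<in> V" using assms ldr verts_Gv by auto
  have *: "Lam p = Lam q" "Lam p = None \<longrightarrow> (?h p, ?h q) \<in> (link F)\<^sup>*"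
    using connected_iff[OF assms(1,2)] assms(3) by (auto simp: Lam_def)
  show ?thesis
    using slot_round_const[OF h assms(1) _ *(2), of "\<beta> + 2"]
      slot_round_const[OF h assms(1) _ *(2), of "2 * \<beta> + 4"] *(1)
    unfolding y_def z_def by simp
qed

text \<open>Members with a common label may be hosted anywhere in \<open>G\<close>, while an
  unlabelled supernode is a part.\<close>

definition scope :: "node \<Rightarrow> node set" where
  "scope w = (if Lam w = None then supernode_of G F w else V)"

lemma scope_sub: "scope w \<subseteq> V" by (auto simp: scope_def supernode_of_def V_def)

lemma finite_scope: "finite (scope w)" by (rule finite_subset[OF scope_sub finite_V])

lemma scope_agg:
  assumes "w \<in> verts Gv" "d \<in> {\<beta> + 2, 2 * \<beta> + 4}"
  shows "aggregates_opt (sub_op \<beta> fc fa (d + slot W (Lam w)))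
    (\<Sum>v\<in>scope w. mset_opt (N v (d + slot W (Lam w))))
    (Y (if w \<in> W then ldr else w) (d + slot W (Lam w)))"
proof (cases "Lam w")
  case None
  then have "w \<in> V" "w \<notin> W" using assms verts_Gv by (auto simp: Lam_def split: if_splits)
  then show ?thesis using part_agg[of d w] assms None by (auto simp: slot_def scope_def)
next
  case (Some l)
  have "slot W (Lam w) \<le> \<beta>" "slot W (Lam w) > 0"
    using slot_le[OF assms(1)] Some Lam_rep[OF assms(1) Some] by (auto simp: slot_def)
  moreover have "(if w \<in> W then ldr else w) \<in> V" using assms ldr verts_Gv by auto
  moreover have "scope w = V" using Some by (simp add: scope_def)
  ultimately show ?thesis using assms(2) full_agg[of "d + slot W (Lam w)"
    "if w \<in> W then ldr else w"]
    by auto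
qed

lemma supernode_eq: "w \<in> verts Gv \<Longrightarrow> supernode_of Gv Fv w =
   {v \<in> verts Gv. Lam v = Lam w \<and> (Lam w = None \<longrightarrow> (w, v) \<in> (link F)\<^sup>*)}"
  using connected_iff[of w] by (auto simp: supernode_of_def)

text \<open>The sets \<open>?T v\<close> for \<open>v\<close> in \<open>scope w\<close> partition
  the supernode, so aggregating first at each host and then over the scope is an admissible
  order.\<close>

lemma y_agg:
  assumes "w \<in> verts Gv"
  shows "aggregates fc (image_mset x (mset_set (supernode_of Gv Fv w))) (y w)"
proof -
  let ?T = "\<lambda>v. {u \<in> hosted_nodes G Gv ldr v. Lam u = Lam w}"
  have fin: "finite (?T v)" for v using finite_W by (auto simp: hosted_nodes_def W_def)
  have N: "N v (\<beta> + 2 + slot W (Lam w)) = local_agg fc (image_mset x (mset_set (?T v)))"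
    if "v \<in> V" for v
  proof -
    have "{u \<in> hosted_nodes G Gv ldr v. label_of \<beta> W (Y v) u = Lam w} = ?T v"
      using label_of_eq[OF that] by (auto simp: hosted_nodes_def W_def split: if_splits)
    then show ?thesis using slot_le[OF assms] target_slot[OF assms] by (simp add: N_eq sub_msg_def)
  qed
  have "aggregates_opt fc (\<Sum>v\<in>scope w. image_mset x (mset_set (?T v)))
     (Y (if w \<in> W then ldr else w) (\<beta> + 2 + slot W (Lam w)))"
    by (rule aggregates_opt_sum[OF finite_scope, where v = "\<lambda>v. N v (\<beta> + 2 + slot W (Lam w))"])
      (use N scope_sub local_agg scope_agg[OF assms, of "\<beta> + 2"] slot_le[OF assms] in
        \<open>auto simp: sub_op_def subset_iff\<close>)
  also have "(\<Sum>v\<in>scope w. image_mset x (mset_set (?T v))) =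
      image_mset x (mset_set (\<Union>v\<in>scope w. ?T v))"
    by (rule sum_mset_set_UNION[OF finite_scope fin])
      (use scope_sub verts_Gv(2) in \<open>auto simp: hosted_nodes_def W_def subset_iff split: if_splits\<close>)
  also have "(\<Union>v\<in>scope w. ?T v) = supernode_of Gv Fv w"
  proof (cases "Lam w")
    case None
    then show ?thesis unfolding supernode_eq[OF assms]
      using verts_Gv by (auto simp: scope_def hosted_nodes_def supernode_of_def Lam_def W_def
        V_def split: if_splits)
  next
    case (Some l)
    then show ?thesis unfolding supernode_eq[OF assms]
      using verts_Gv ldr by (auto simp: scope_def hosted_nodes_def W_def V_def split: if_splits)
  qed
  finally have *: "aggregates_opt fc (image_mset x (mset_set (supernode_of Gv Fv w)))
     (Y (if w \<in> W then ldr else w) (\<beta> + 2 + slot W (Lam w)))" .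
  \<comment> \<open>The supernode is not empty, so the outcome is not \<open>None\<close> and
    \<open>the\<close> in \<open>y\<close> is harmless.\<close>
  have "finite (supernode_of Gv Fv w)" "w \<in> supernode_of Gv Fv w"
    using finite_Gv assms by (auto simp: supernode_of_def)
  then have "mset_set (supernode_of Gv Fv w) \<noteq> {#}" by (auto simp: mset_set_empty_iff)
  then show ?thesis using * unfolding y_def
    by (cases "Y (if w \<in> W then ldr else w) (\<beta> + 2 + slot W (Lam w))")
      (auto simp: aggregates_opt_def)
qed

end

locale phase_exchange = phase +
  \<comment> \<open>Kept apart from \<open>phase\<close> since it refers to \<open>entG\<close>, and
    since verifying it for the algorithm uses consequences of \<open>phase\<close>.\<close>
  assumes exch0: "\<And>u. u \<in> verts G \<Longrightarrow> aggregates_opt fa (image_mset (\<lambda>e. ag e (entG e) u)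
      (mset_set {e \<in> edges G. u \<in> e \<and> entG e \<noteq> {}})) (Zx u)"
begin

lemmas exch = exch0[folded V_def]

text \<open>Every incidence of an edge with an end point is charged to a node of \<open>G\<close>:
  for a virtual edge to its host (\<open>T\<close>), for an edge of \<open>G\<close> to the end
  point itself (\<open>R\<close>). The sets \<open>T v \<union> R v\<close> over the scope partition
  the incidences of the supernode.\<close>

lemma z_agg:
  assumes w: "w \<in> verts Gv"
  shows "aggregates_opt fa (image_mset (\<lambda>(e, u). ag e (ent e) u)
    (mset_set {(e, u). e \<in> minor_edges Gv Fv \<and> u \<in> e \<inter> supernode_of Gv Fv w})) (z w)"
proof -
  let ?g = "\<lambda>(e, u). ag e (ent e) u"
  define d where "d = 2 * \<beta> + 4"
  define T where "T = (\<lambda>v. {(e, u). e \<in> hosted_edges G Gv ldr v \<and> ent e \<noteq> {} \<and> u \<in> e \<and> Lam u =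
    Lam w})"
  define R where "R = (\<lambda>v. {(e, u). e \<in> edges G \<and> ent e \<noteq> {} \<and> u \<in> e \<and> u = v \<and> Lam u = Lam w})"
  have ent_ne: "ent e \<noteq> {} \<longleftrightarrow> e \<in> minor_edges Gv Fv" if "e \<in> edges Gv" for e
    using that simple_Gv by (auto simp: ent_def simple_graph_def)
  have finP: "finite (SIGMA e:edges Gv. e)"
    using finite_edges simple_Gv finite_Gv by (auto simp: simple_graph_def intro: finite_subset)
  have TR: "T v \<subseteq> (SIGMA e:edges Gv. e)" "R v \<subseteq> (SIGMA e:edges Gv. e)" "T v \<inter> R v = {}" if "v \<in> V"
    for v
    using hosted_edge_sub[of _ v] that edges_sub
    by (auto simp: T_def R_def virtual_edges_def)
  have fin: "finite (T v)" "finite (R v)" if "v \<in> V" for v 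
    using finite_subset[OF TR(1)[OF that] finP] finite_subset[OF TR(2)[OF that] finP] by auto
  \<comment> \<open>The exchange round has condensed the incidences in \<open>R v\<close> into the
    single message \<open>Zx v\<close>.\<close>
  define zz where "zz = (\<lambda>v. if Lam v = Lam w then Zx v else None)"
  have Rz: "aggregates_opt fa (image_mset ?g (mset_set (R v))) (zz v)" if v: "v \<in> V" for v
  proof (cases "Lam v = Lam w")
    case True
    have "{e \<in> edges G. v \<in> e \<and> entG e \<noteq> {}} = {e \<in> edges G. v \<in> e \<and> ent e \<noteq> {}}" (is "?E' = ?E")
      using entG_eq by auto
    moreover have "R v = (\<lambda>e. (e, v)) ` ?E" using True by (auto simp: R_def)
    moreover have "finite ?E" using finite_edges edges_sub by (auto intro: finite_subset)
    moreover have "image_mset (\<lambda>e. ag e (entG e) v) (mset_set ?E) =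
      image_mset (\<lambda>e. ag e (ent e) v) (mset_set ?E)"
      using entG_eq \<open>finite ?E\<close> by (intro image_mset_cong) auto
    moreover have "mset_set ((\<lambda>e. (e, v)) ` ?E) = image_mset (\<lambda>e. (e, v)) (mset_set ?E)"
      by (rule image_mset_mset_set[symmetric]) (auto simp: inj_on_def)
    ultimately have "image_mset (\<lambda>e. ag e (entG e) v) (mset_set ?E') =
      image_mset ?g (mset_set (R v))"
      by (simp add: multiset.map_comp comp_def)
    then show ?thesis using exch[OF v] True by (simp add: zz_def)
  next
    case False
    then have "R v = {}" by (auto simp: R_def)
    then show ?thesis using False by (simp add: zz_def aggregates_opt_def)
  qed
  have N: "N v (d + slot W (Lam w)) = local_agg fa (mset_opt (zz v) + image_mset ?g (mset_set
    (T v)))"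
    if v: "v \<in> V" for v
  proof -
    have ve: "virt_entry \<beta> W (Y v) e = ent e" if "e \<in> hosted_edges G Gv ldr v" for e
      using that hosted_edge_sub[OF that v] virt_entry_eq[OF v] by blast
    have lb: "label_of \<beta> W (Y v) u = Lam u" if "e \<in> hosted_edges G Gv ldr v" "u \<in> e" for e u
      using hosted_edge_sub[OF that(1) v] that(2) label_of_eq[OF v, of u] by auto
    have *: "{(e, u). e \<in> hosted_edges G Gv ldr v \<and> virt_entry \<beta> W (Y v) e \<noteq> {} \<and> u \<in> e \<and>
        label_of \<beta> W (Y v) u = Lam w} = T v"
      using ve lb unfolding T_def by auto
    have "image_mset (\<lambda>(e, u). ag e (virt_entry \<beta> W (Y v) e) u) (mset_set (T v)) =
      image_mset ?g (mset_set (T v))"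
      using ve fin[OF v] by (intro image_mset_cong) (auto simp: T_def)
    then show ?thesis using label_of_eq[OF v, of v] target_slot[OF w] *
      by (simp add: N_eq sub_msg_def d_def zz_def)
  qed
  have Na: "aggregates_opt fa (image_mset ?g (mset_set (T v \<union> R v))) (N v (d + slot W (Lam w)))"
    if v: "v \<in> V" for v
  proof -
    \<comment> \<open>Written as a sum over a singleton so that
      \<open>aggregates_opt_sum_gen\<close> expands \<open>zz v\<close> alone and keeps
      \<open>T v\<close> as the remainder.\<close>
    have "aggregates_opt fa ((\<Sum>u\<in>{v}. image_mset ?g (mset_set (R u))) + image_mset ?g (mset_set
      (T v)))
       (N v (d + slot W (Lam w)))"
      by (rule aggregates_opt_sum_gen[where v = zz]) (use Rz v N[OF v] local_agg in auto)
    then show ?thesis using fin[OF v] TR(3)[OF v] by (simp add: mset_set_Union add.commute)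
  qed
  have "aggregates_opt fa (\<Sum>v\<in>scope w. image_mset ?g (mset_set (T v \<union> R v)))
     (Y (if w \<in> W then ldr else w) (d + slot W (Lam w)))"
    by (rule aggregates_opt_sum[OF finite_scope, where v = "\<lambda>v. N v (d + slot W (Lam w))"])
      (use Na scope_sub scope_agg[OF w, of d] in \<open>auto simp: sub_op_def subset_iff d_def\<close>)
  also have "(\<Sum>v\<in>scope w. image_mset ?g (mset_set (T v \<union> R v))) =
      image_mset ?g (mset_set (\<Union>v\<in>scope w. T v \<union> R v))"
  proof (rule sum_mset_set_UNION[OF finite_scope])
    fix u v assume uv: "u \<in> scope w" "v \<in> scope w" "u \<noteq> v"
    then have "u \<in> V" "v \<in> V" using scope_sub by auto
    then show "(T u \<union> R u) \<inter> (T v \<union> R v) = {}"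
      using hosted_edges_disjoint[of u v] uv(3) hosted_edge_sub[of _ u] hosted_edge_sub[of _ v]
      by (auto simp: T_def R_def virtual_edges_def)
  qed (use fin scope_sub in blast)
  also have "(\<Union>v\<in>scope w. T v \<union> R v) =
      {(e, u). e \<in> minor_edges Gv Fv \<and> u \<in> e \<inter> supernode_of Gv Fv w}" (is "?A = ?B")
  proof (intro equalityI subsetI)
    fix p assume "p \<in> ?A"
    then obtain v e u where p: "p = (e, u)" and v: "v \<in> scope w" and eu: "(e, u) \<in> T v \<union> R v"
      by (cases p) auto
    have vV: "v \<in> V" using v scope_sub by auto
    have e: "e \<in> edges Gv" "u \<in> e" "ent e \<noteq> {}" "Lam u = Lam w"
      using eu TR[OF vV] by (auto simp: T_def R_def)
    have u: "u \<in> verts Gv" using e simple_Gv by (auto simp: simple_graph_def)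
    \<comment> \<open>An unlabelled \<open>u\<close> lies in \<open>G\<close>, and its incidences
      are charged to \<open>u\<close> itself.\<close>
    have "(w, u) \<in> (link F)\<^sup>*" if "Lam w = None"
    proof -
      have "u \<in> V" "u \<notin> W" using that e u verts_Gv by (auto simp: Lam_def split: if_splits)
      then have "u = v" using eu hosted_edge_sub[of e v] vV by (auto simp: T_def R_def)
      then show ?thesis using v that by (simp add: scope_def supernode_of_def)
    qed
    then show "p \<in> ?B" using p e ent_ne u supernode_eq[OF w] by auto
  next
    fix p assume "p \<in> ?B"
    then obtain e u where p: "p = (e, u)" and e: "e \<in> minor_edges Gv Fv" "u \<in> e"
      and u: "u \<in> verts Gv" "Lam u = Lam w" "Lam w = None \<Longrightarrow> (w, u) \<in> (link F)\<^sup>*"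
      using supernode_eq[OF w] by auto
    have eE: "e \<in> edges Gv" "ent e \<noteq> {}" using e ent_ne by (auto simp: minor_edges_def)
    have sc: "u \<in> scope w" if "u \<in> V" using that u by (auto simp: scope_def supernode_of_def V_def)
    have scW: "scope w = V" if "u \<in> W" using that u by (auto simp: scope_def Lam_def)
    from eE(1) show "p \<in> ?A"
    proof (cases rule: edge_cases)
      case (real a b)
      then have "u \<in> V" using e by auto
      then show ?thesis using p e eE u real sc by (auto simp: R_def)
    next
      case (mixed a b)
      then have "e \<in> hosted_edges G Gv ldr a" by (auto simp: hosted_edges_def)
      then have "p \<in> T a" using p e eE u by (auto simp: T_def)
      moreover have "a \<in> scope w" using sc scW mixed e by auto
      ultimately show ?thesis by auto
    next
      case (virt a b)
      then have "e \<in> hosted_edges G Gv ldr ldr" by (auto simp: hosted_edges_def W_def)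
      then have "p \<in> T ldr" using p e eE u by (auto simp: T_def)
      moreover have "ldr \<in> scope w" using scW virt e ldr by auto
      ultimately show ?thesis by auto
    qed
  qed
  finally show ?thesis by (simp add: z_def d_def)
qed

end

subsection \<open>The simulating algorithm\<close>

lemma labels_cong: "(\<And>i. i < k + 2 \<Longrightarrow> ys i = ys' i) \<Longrightarrow> labels ys k = labels ys' k"
proof (induction k)
  case (Suc k)
  then have "labels ys k = labels ys' k" "ys (k + 2) = ys' (k + 2)" by auto
  then show ?case unfolding labels.simps by metis
qed simp

lemma label_of_cong:
  assumes "\<And>i. i < \<beta> + 2 \<Longrightarrow> ys i = ys' i" shows "label_of \<beta> W ys = label_of \<beta> W ys'"
proof -
  have "labels ys \<beta> = labels ys' \<beta>" "ys 1 = ys' 1" using assms by (auto intro: labels_cong)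
  then show ?thesis unfolding label_of_def by metis
qed

context
  fixes W :: "node set" and \<beta> :: nat
  assumes W: "finite W" "card W \<le> \<beta>"
begin

lemma cons_result_cong:
  assumes "\<And>i. i < 2 * \<beta> + 3 \<Longrightarrow> ys i = ys' i"
  shows "cons_result \<beta> W ys = cons_result \<beta> W ys'"
proof -
  have "label_of \<beta> W ys = label_of \<beta> W ys'" by (rule label_of_cong) (use assms in auto)
  moreover have "\<beta> + 2 + slot W l < 2 * \<beta> + 3" for l
    using slot_le_card[OF W(1), of l] W(2) by auto
  ultimately show ?thesis using assms by (auto simp: cons_result_def fun_eq_iff)
qed

lemma agg_result_cong:
  assumes "\<And>i. i < 3 * \<beta> + 5 \<Longrightarrow> ys i = ys' i"
  shows "agg_result \<beta> W ys = agg_result \<beta> W ys'"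
proof -
  have "label_of \<beta> W ys = label_of \<beta> W ys'" by (rule label_of_cong) (use assms in auto)
  moreover have "2 * \<beta> + 4 + slot W l < 3 * \<beta> + 5" for l
    using slot_le_card[OF W(1), of l] W(2) by auto
  ultimately show ?thesis using assms by (auto simp: agg_result_def fun_eq_iff)
qed

lemma virt_entry_cong:
  assumes "\<And>i. i < 2 * \<beta> + 3 \<Longrightarrow> ys i = ys' i"
  shows "virt_entry \<beta> W ys = virt_entry \<beta> W ys'"
  using label_of_cong[of \<beta> ys ys' W] cons_result_cong[of ys ys'] assms
  by (auto simp: virt_entry_def fun_eq_iff)

text \<open>In the middle of a phase a node knows only a prefix of its log, whereas
  \<open>phase\<close> speaks of the complete one. A message of round \<open>j\<close> looks at
  rounds before \<open>j\<close> only, and at \<open>zx\<close> only after the exchange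
  round.\<close>

lemma sub_msg_cong:
  assumes ys: "\<And>i. i < j \<Longrightarrow> ys i = ys' i" and zx: "j > 2 * \<beta> + 3 \<Longrightarrow> zx = zx'"
    and x: "\<And>v. v \<in> Hn \<Longrightarrow> x v = x' v" and a: "\<And>e S v. e \<in> He \<Longrightarrow> a e S v = a' e S v"
  shows "sub_msg \<beta> W u Hn He K x a fc fa ys zx j = sub_msg \<beta> W u Hn He K x' a' fc fa ys' zx' j"
proof -
  consider "j < 2" | "2 \<le> j" "j < \<beta> + 2" | "\<beta> + 2 \<le> j" "j < 2 * \<beta> + 3" | "j =
    2 * \<beta> + 3" | "2 * \<beta> + 4 \<le> j"
    by linarith
  then show ?thesis
  proof cases
    case 1
    then show ?thesis by (simp add: sub_msg_def)
  next
    case 2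
    then have "labels ys (j - 2) = labels ys' (j - 2)" "ys 1 = ys' 1"
      using ys by (auto intro!: labels_cong)
    then show ?thesis using 2 by (simp add: sub_msg_def proposals_def)
  next
    case 3
    then have "label_of \<beta> W ys = label_of \<beta> W ys'" using ys by (intro label_of_cong) auto
    then show ?thesis using 3 x by (auto simp: sub_msg_def intro!: arg_cong[of _ _
      "local_agg fc"] image_mset_set_cong)
  next
    case 4
    then have "label_of \<beta> W ys = label_of \<beta> W ys'" "cons_result \<beta> W ys = cons_result \<beta> W ys'"
      using ys by (auto intro!: label_of_cong cons_result_cong)
    then show ?thesis using 4 by (simp add: sub_msg_def)
  next
    case 5
    then have *: "label_of \<beta> W ys = label_of \<beta> W ys'" "virt_entry \<beta> W ys = virt_entry \<beta> W ys'"
      using ys by (auto intro!: label_of_cong virt_entry_cong)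
    have "zx = zx'" using zx 5 by auto
    moreover have "image_mset (\<lambda>(e, w). a e (virt_entry \<beta> W ys' e) w) (mset_set
       {(e, w). e \<in> He \<and> virt_entry \<beta> W ys' e \<noteq> {} \<and> w \<in> e \<and> label_of \<beta> W ys' w =
         target W (j - (2 * \<beta> + 4))}) =
      image_mset (\<lambda>(e, w). a' e (virt_entry \<beta> W ys' e) w) (mset_set
       {(e, w). e \<in> He \<and> virt_entry \<beta> W ys' e \<noteq> {} \<and> w \<in> e \<and> label_of \<beta> W ys' w =
         target W (j - (2 * \<beta> + 4))})"
      by (rule image_mset_set_cong) (use a in auto)
    ultimately show ?thesis using 5 * by (simp add: sub_msg_def)
  qed
qed

end

section \<open>Lengths of the messages of a phase\<close>

lemma local_agg_length:
  assumes "\<And>p. p \<in># M \<Longrightarrow> length p \<le> b" "\<And>p q. length (f p q) \<le> b" "local_agg f M = Some m"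
  shows "length m \<le> b"
  using aggregates_opt_closed[OF local_agg[of f M], of "\<lambda>p. length p \<le> b" f] assms by auto

text \<open>The longest messages counted here are pairs of IDs, of length at most
  \<open>2 * b + b + 1\<close>. Round \<open>2 * \<beta> + 3\<close> is left out because its message
  quotes received values, which are known to be short only in an actual run.\<close>

lemma sub_msg_length:
  assumes "j \<noteq> 2 * \<beta> + 3" "sub_msg \<beta> W u Hn He K x a fc fa ys zx j = Some m"
    and "length u \<le> b" "\<And>w. w \<in> W \<Longrightarrow> length w \<le> b" "\<And>v. length (x v) \<le> b"
    "\<And>e S v. length (a e S v) \<le> b" "\<And>p q. length (fc p q) \<le> b" "\<And>p q. length (fa p q) \<le> b"
    "\<And>p. zx = Some p \<Longrightarrow> length p \<le> b"
  shows "length m \<le> 3 * b + 1"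
proof -
  consider "j = 0" | "j = 1" | "2 \<le> j" "j < \<beta> + 2" | "\<beta> + 2 \<le> j" "j < 2 * \<beta> + 3" | "2 * \<beta> + 4 \<le> j"
    using assms(1) by linarith
  then show ?thesis
  proof cases
    case 1
    then show ?thesis using assms by (simp add: sub_msg_def)
  next
    case 2
    then have "m \<in> W" using assms by (auto simp: sub_msg_def dest: pick_in)
    then show ?thesis using assms(4)[of m] by simp
  next
    case 3
    then obtain p q where "m = pair_msg p q" "(p, q) \<in> proposals W u K ys (j - 2)"
      using assms(2) by (auto simp: sub_msg_def dest: pick_in)
    then show ?thesis using assms(4)[of p] assms(4)[of q] by (auto simp: proposals_def)
  next
    case 4
    then have "local_agg fc (image_mset x (mset_set {w \<in> Hn. label_of \<beta> W ys w =
      target W (j - (\<beta> + 2))})) = Some m"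
      using assms(2) by (simp add: sub_msg_def)
    from local_agg_length[OF _ assms(7) this] assms(5) have "length m \<le> b" by auto
    then show ?thesis by simp
  next
    case 5
    then have *: "local_agg fa (mset_opt (if label_of \<beta> W ys u =
      target W (j - (2 * \<beta> + 4)) then zx else None) +
        image_mset (\<lambda>(e, w). a e (virt_entry \<beta> W ys e) w)
          (mset_set {(e, w). e \<in> He \<and> virt_entry \<beta> W ys e \<noteq> {} \<and> w \<in> e \<and>
             label_of \<beta> W ys w = target W (j - (2 * \<beta> + 4))})) = Some m"
      using assms(2) by (simp add: sub_msg_def)
    have "length m \<le> b"
      by (rule local_agg_length[OF _ assms(8) *])
        (use assms(6,9) in \<open>auto simp: mset_opt_def split: option.splits if_splits\<close>)
    then show ?thesis by simp
  qed
qed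

section \<open>Reading the simulated logs off the logs on \<open>G\<close>\<close>

definition phase_len :: "nat \<Rightarrow> nat" where
  "phase_len \<beta> = 3 * \<beta> + 5"

definition decoded :: "nat \<Rightarrow> node_log \<Rightarrow> nat \<Rightarrow> nat \<Rightarrow> msg option" where
  "decoded \<beta> l q i = msg_opt (fst (l ! (q * phase_len \<beta> + i)))"

text \<open>The aggregation half of a round carries information only in the exchange round.
  \<open>Option.bind\<close> merges the two ways of having nothing: no incident edge, or only empty
  messages.\<close>

definition edge_agg :: "nat \<Rightarrow> node_log \<Rightarrow> nat \<Rightarrow> msg option" where
  "edge_agg \<beta> l q = Option.bind (snd (l ! (q * phase_len \<beta> + (2 * \<beta> + 3)))) msg_opt"

definition node_log_of :: "nat \<Rightarrow> node set \<Rightarrow> node_log \<Rightarrow> nat \<Rightarrow> node \<Rightarrow> node_log" where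
  "node_log_of \<beta> W l q x = map (\<lambda>p. (cons_result \<beta> W (decoded \<beta> l p) x, agg_result \<beta> W
    (decoded \<beta> l p) x)) [0..<q]"

definition virt_log_of :: "nat \<Rightarrow> node set \<Rightarrow> node_log \<Rightarrow> nat \<Rightarrow> node set \<Rightarrow> edge_log" where
  "virt_log_of \<beta> W l q e = map (\<lambda>p. virt_entry \<beta> W (decoded \<beta> l p) e) [0..<q]"

text \<open>\<open>S1\<close> is what the edge learned when the parts were contracted, so it is empty iff both
  end points lie in the same part.\<close>

definition real_entry :: "(node \<times> msg) set \<Rightarrow> (node \<times> msg) set \<Rightarrow> (node \<times> msg) set" where
  "real_entry S1 S = (if S1 \<noteq> {} \<and> \<not> (\<exists>l. \<forall>(w, m)\<in>S. msg_opt (fst (msg_pair (tl m))) = Some l)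
     then (\<lambda>(w, m). (w, snd (msg_pair (tl m)))) ` S else {})"

definition edge_log_of :: "nat \<Rightarrow> edge_log \<Rightarrow> nat \<Rightarrow> edge_log" where
  "edge_log_of \<beta> l q = map (\<lambda>p. real_entry (l ! (p * phase_len \<beta> + 1)) (l ! (p * phase_len \<beta> +
    (2 * \<beta> + 3)))) [0..<q]"

type_synonym tape_split = "tape \<Rightarrow> unit_of_computation \<Rightarrow> tape"

definition node_msg :: "nat \<Rightarrow> tape_split \<Rightarrow> 'i ma_algorithm \<Rightarrow>
  ('i \<times> 'i storage) node_view \<Rightarrow> nat \<Rightarrow> nat \<Rightarrow> msg option" where
  "node_msg \<beta> ext Av w q j =
    (let u = node_id w; i = fst (node_input w); s = snd (node_input w);
         W = set (virt_ids s); l = node_learned w; ys = decoded \<beta> l q;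
         r = node_tape w;
         Hn = insert u (if ys 0 = Some u then W else {});
         He = virt_incident s \<union> (if ys 0 = Some u then virt_virt s else {})
     in sub_msg \<beta> W u Hn He
          {e \<in> He. contracts Av \<lparr>edge_ends = e, edge_tape = ext r (Edge e), edge_learned =
            virt_log_of \<beta> W l q e\<rparr>}
          (\<lambda>v. cons_value Av \<lparr>node_id = v, node_input = if v = u then i else virt_input s v,
             node_tape = ext r (Node v), node_learned = node_log_of \<beta> W l q v\<rparr>)
          (\<lambda>e S v. agg_value Av \<lparr>edge_ends = e, edge_tape = ext r (Edge e),
             edge_learned = virt_log_of \<beta> W l q e @ [S]\<rparr> v)
          (cons_op Av q) (agg_op Av q) ys (edge_agg \<beta> l q) j)"

text \<open>\<open>take\<close> makes the bound hold for all views, not only those of a run. Origin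
  of \<open>3 * b + 4\<close>: a label with its presence bit takes \<open>b + 1\<close> bits,
  doubled by \<open>pair_msg\<close>; then \<open>b\<close> for the consensus value, 1 for the
  separator and 1 for the outer presence bit. In \<open>agg_value\<close> the current round is
  already logged, hence the \<open>- 1\<close>.\<close>

definition sim_alg :: "nat \<Rightarrow> nat \<Rightarrow> tape_split \<Rightarrow> 'i ma_algorithm \<Rightarrow>
  ('i \<times> 'i storage) ma_algorithm" where
  "sim_alg \<beta> b ext Av = \<lparr>
     rounds = rounds Av * phase_len \<beta>,
     contracts = (\<lambda>w. let t = length (edge_learned w); j = t mod phase_len \<beta> in
       if j \<in> {1, \<beta> + 2, 2 * \<beta> + 4} then
         contracts Av \<lparr>edge_ends = edge_ends w, edge_tape = ext (edge_tape w) (Edge (edge_ends w)),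
           edge_learned = edge_log_of \<beta> (edge_learned w) (t div phase_len \<beta>)\<rparr>
       else j \<noteq> 2 * \<beta> + 3),
     cons_value = (\<lambda>w. let t = length (node_learned w) in
       take (3 * b + 4) (opt_msg (node_msg \<beta> ext Av w (t div phase_len \<beta>) (t mod phase_len \<beta>)))),
     agg_value = (\<lambda>w u. let t = length (edge_learned w) - 1;
         l = edge_log_of \<beta> (edge_learned w) (Suc (t div phase_len \<beta>)) in
       if t mod phase_len \<beta> = 2 * \<beta> + 3 \<and> last l \<noteq> {} then
         True # agg_value Av \<lparr>edge_ends = edge_ends w,
           edge_tape = ext (edge_tape w) (Edge (edge_ends w)), edge_learned = l\<rparr> u
       else []),
     cons_op = (\<lambda>t. lift_op (sub_op \<beta> (cons_op Av (t div phase_len \<beta>))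
       (agg_op Av (t div phase_len \<beta>)) (t mod phase_len \<beta>))),
     agg_op = (\<lambda>t. lift_op (agg_op Av (t div phase_len \<beta>)))\<rparr>"

lemma lift_op_length:
  "length x \<le> b' \<Longrightarrow> length y \<le> b' \<Longrightarrow>
   (\<And>p q. msg_opt x = Some p \<Longrightarrow> msg_opt y = Some q \<Longrightarrow> length (f p q) < b') \<Longrightarrow>
     length (lift_op f x y) \<le> b'"
  by (cases "msg_opt x"; cases "msg_opt y") (auto simp: lift_op_def Suc_le_eq)

lemma msg_opt_length: "msg_opt x = Some p \<Longrightarrow> length x = Suc (length p)"
  by (cases x) auto

definition ops_bounded :: "nat \<Rightarrow> 'i ma_algorithm \<Rightarrow> bool" where
  "ops_bounded b A \<longleftrightarrow> (\<forall>t x y. length (cons_op A t x y) \<le> b \<and> length (agg_op A t x y) \<le> b)"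

lemma bit_bounded_sim_alg:
  assumes "bit_bounded b Av" "ops_bounded b Av"
  shows "bit_bounded (3 * b + 4) (sim_alg \<beta> b ext Av)"
  unfolding bit_bounded_def
proof (intro conjI allI impI)
  fix w u
  show "length (cons_value (sim_alg \<beta> b ext Av) w) \<le> 3 * b + 4"
    by (simp add: sim_alg_def Let_def)
next
  fix w u
  have "length (True # agg_value Av w' u) \<le> 3 * b + 4" for w'
  proof -
    have "length (agg_value Av w' u) \<le> b" using assms(1) by (simp add: bit_bounded_def)
    then show ?thesis by simp
  qed
  then show "length (agg_value (sim_alg \<beta> b ext Av) w u) \<le> 3 * b + 4"
    unfolding sim_alg_def Let_def ma_algorithm.simps by (simp only: split: if_split) simp
next
  fix t and x y :: msg
  assume xy: "length x \<le> 3 * b + 4" "length y \<le> 3 * b + 4"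
  have f: "length (cons_op Av q p p') < 3 * b + 4" "length (agg_op Av q p p') < 3 * b + 4"
    for q p p'
    using assms(2) by (auto simp: ops_bounded_def less_eq_Suc_le intro: order_trans[of _ b])
  show "length (cons_op (sim_alg \<beta> b ext Av) t x y) \<le> 3 * b + 4"
    unfolding sim_alg_def ma_algorithm.simps
    by (rule lift_op_length) (use xy f in \<open>auto simp: sub_op_def min_id_def dest!: msg_opt_length\<close>)
  show "length (agg_op (sim_alg \<beta> b ext Av) t x y) \<le> 3 * b + 4"
    unfolding sim_alg_def ma_algorithm.simps by (rule lift_op_length) (use xy f in auto)
qed

subsection \<open>Correctness of the simulation\<close>

lemma aggregates_singleton: "aggregates f {#a#} m \<Longrightarrow> m = a"
  by (erule aggregates.cases) auto

lemma aggregates_opt_lift_op: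
  "aggregates_opt (lift_op f) M r \<Longrightarrow>
    aggregates_opt f (\<Sum>x\<in>#M. mset_opt (msg_opt x)) (Option.bind r msg_opt)"
  by (cases r) (auto simp: aggregates_opt_def[of
    "lift_op f"] aggregates_opt_def[of _ _ None] dest: aggregates_lift_op)

lemma sum_mset_opt_if:
  "finite S \<Longrightarrow> (\<Sum>e\<in>S. mset_opt (if P e then Some (g e) else None)) =
    image_mset g (mset_set {e \<in> S. P e})"
proof (induction S rule: finite_induct)
  case (insert e S)
  have "{d \<in> insert e S. P d} = (if P e then insert e {d \<in> S. P d} else {d \<in> S. P d})" by auto
  with insert show ?case by auto
qed simp

text \<open>Logs only grow, so every intermediate log is a prefix of the final one, and the whole
  run can be read off the final logs.\<close>

lemma append_sequence:
  fixes f :: "nat \<Rightarrow> 'a list"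
  assumes "f 0 = []" "\<And>t. t < T \<Longrightarrow> \<exists>x. f (Suc t) = f t @ [x]"
  shows "t \<le> T \<Longrightarrow> length (f t) = t" "t \<le> T \<Longrightarrow> f t = take t (f T)"
proof -
  show len: "length (f t) = t" if "t \<le> T" for t
    using that
  proof (induction t)
    case (Suc t)
    then show ?case using assms(2)[of t] by auto
  qed (simp add: assms(1))
  assume "t \<le> T"
  then show "f t = take t (f T)"
  proof (induction t rule: inc_induct)
    case base
    then show ?case using len[of T] by simp
  next
    case (step t)
    obtain x where "f (Suc t) = f t @ [x]" using assms(2)[of t] step by auto
    then have "take t (take (Suc t) (f T)) = f t" using step.IH len[of t] step.hyps
      by (metis append_eq_conv_conj less_imp_le)
    then show ?case by simp
  qed
qed

lemma nth_last_of_take: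
  assumes "length l = t" "l @ [x] = take (Suc t) L" shows "L ! t = x"
  using assms by (metis lessI nth_append_length nth_take)

lemma ma_round_appends:
  assumes "ma_round A G inp \<omega> t c c'"
  shows "v \<in> verts G \<Longrightarrow> \<exists>x. nlog c' v = nlog c v @ [x]"
    and "e \<in> edges G \<Longrightarrow> \<exists>x. elog c' e = elog c e @ [x]"
  using assms unfolding ma_round_def Let_def by blast+

text \<open>A virtual edge has at most one end point in \<open>G\<close>, so the choice is
  determined.\<close>

definition host :: "graph \<Rightarrow> node \<Rightarrow> unit_of_computation \<Rightarrow> unit_of_computation" where
  "host G ldr x = (case x of Node v \<Rightarrow> Node (if v \<in> verts G then v else ldr)
     | Edge e \<Rightarrow> if e \<in> edges G then Edge e
         else Node (if e \<inter> verts G = {} then ldr else SOME u. u \<in> e \<inter> verts G))"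

locale sim_run = virt_ext G Gv ldr for G Gv :: graph and ldr :: node +
  fixes Av :: "'i ma_algorithm" and \<beta> b :: nat and ext :: tape_split
    and inp :: "node \<Rightarrow> 'i" and st :: "node \<Rightarrow> 'i storage" and \<omega> \<omega>' :: coins
    and c :: "nat \<Rightarrow> config" and T :: nat
  assumes connected: "connected_graph G" and card_virt: "card (virtual_nodes G Gv) \<le> \<beta>"
    and bounded: "bit_bounded b Av" and ops: "ops_bounded b Av"
    and ids: "\<And>v. v \<in> verts Gv \<Longrightarrow> length v \<le> b"
    and stored: "distributedly_stored G Gv inp st"
    and ldr_min: "\<And>v. v \<in> verts G \<Longrightarrow> to_nat ldr \<le> to_nat v"
    \<comment> \<open>All that the simulation itself needs to know about randomness; distributions
      come in only with \<open>coin_map\<close>.\<close>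
    and coins: "\<And>x. x \<in> units Gv \<Longrightarrow> (\<lambda>k. \<omega>' (x, k)) = ext (\<lambda>k. \<omega> (host G ldr x, k)) x"
    and c0: "c 0 = \<lparr>nlog = (\<lambda>_. []), elog = (\<lambda>_. [])\<rparr>"
    and step: "\<And>t. t < T \<Longrightarrow> ma_round (sim_alg \<beta> b ext Av) G (\<lambda>u. (inp u, st u)) \<omega> t (c t) (c
      (Suc t))"
begin

abbreviation "A \<equiv> sim_alg \<beta> b ext Av"
abbreviation "P \<equiv> phase_len \<beta>"

definition "NL u = nlog (c T) u"
definition "EL e = elog (c T) e"

lemma nlog_take:
  assumes "u \<in> V" "t \<le> T"
  shows "nlog (c t) u = take t (NL u)" "length (nlog (c t) u) = t"
proof -
  have "\<exists>x. nlog (c (Suc t)) u = nlog (c t) u @ [x]" if "t < T" for t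
    using ma_round_appends(1)[OF step[OF that]] assms(1) by (simp add: V_def)
  from append_sequence[of "\<lambda>t. nlog (c t) u" T t, OF _ this] assms c0
  show "nlog (c t) u = take t (NL u)" "length (nlog (c t) u) = t" by (auto simp: NL_def)
qed

lemma elog_take:
  assumes "e \<in> edges G" "t \<le> T"
  shows "elog (c t) e = take t (EL e)" "length (elog (c t) e) = t"
proof -
  have "\<exists>x. elog (c (Suc t)) e = elog (c t) e @ [x]" if "t < T" for t
    using ma_round_appends(2)[OF step[OF that]] assms(1) by simp
  from append_sequence[of "\<lambda>t. elog (c t) e" T t, OF _ this] assms c0
  show "elog (c t) e = take t (EL e)" "length (elog (c t) e) = t" by (auto simp: EL_def)
qed

definition "FA t = {e \<in> edges G. contracts A (eview \<omega> (c t) e)}"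
definition "sent t v = cons_value A (nview (\<lambda>u. (inp u, st u)) \<omega> (c t) v)"

lemma round_facts:
  assumes t: "t < T"
  shows "\<And>u v. u \<in> V \<Longrightarrow> v \<in> V \<Longrightarrow> (u, v) \<in> (link (FA t))\<^sup>* \<Longrightarrow> NL u ! t = NL v ! t"
    and "\<And>u. u \<in> V \<Longrightarrow> aggregates (cons_op A t)
      (image_mset (sent t) (mset_set (supernode_of G (FA t) u))) (fst (NL u ! t))"
    and "\<And>e. e \<in> edges G \<Longrightarrow> EL e ! t =
      (if e \<in> minor_edges G (FA t) then (\<lambda>u. (u, fst (NL u ! t))) ` e else {})"
    and "\<And>u. u \<in> V \<Longrightarrow> aggregates_opt (agg_op A t)
       (image_mset (\<lambda>(e, u). agg_value A (eview \<omega> (c (Suc t)) e) u)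
         (mset_set {(e, w). e \<in> minor_edges G (FA t) \<and>
           w \<in> e \<inter> supernode_of G (FA t) u})) (snd (NL u ! t))"
proof -
  obtain y z where yz:
    "\<And>u v. u \<in> V \<Longrightarrow> v \<in> V \<Longrightarrow> (u, v) \<in> (link (FA t))\<^sup>* \<Longrightarrow> y u = y v \<and> z u = z v"
    "\<And>v. v \<in> V \<Longrightarrow> aggregates (cons_op A t)
       (image_mset (sent t) (mset_set (supernode_of G (FA t) v))) (y v)"
    "\<And>e. e \<in> edges G \<Longrightarrow> elog (c (Suc t)) e =
       elog (c t) e @ [if e \<in> minor_edges G (FA t) then (\<lambda>u. (u, y u)) ` e else {}]"
    "\<And>v. v \<in> V \<Longrightarrow> aggregates_opt (agg_op A t)
       (image_mset (\<lambda>(e, u). agg_value A (eview \<omega> (c (Suc t)) e) u)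
         (mset_set {(e, u). e \<in> minor_edges G (FA t) \<and> u \<in> e \<inter> supernode_of G (FA t) v})) (z v)"
    "\<And>v. v \<in> V \<Longrightarrow> nlog (c (Suc t)) v = nlog (c t) v @ [(y v, z v)]"
    by (rule ma_roundE[OF step[OF t], folded FA_def sent_def V_def]) (rule that)
  have NL: "NL u ! t = (y u, z u)" if "u \<in> V" for u
    by (rule nth_last_of_take[of "nlog (c t) u"]) (use nlog_take[OF that] yz(5)[OF that] t in auto)
  show "NL u ! t = NL v ! t" if "u \<in> V" "v \<in> V" "(u, v) \<in> (link (FA t))\<^sup>*" for u v
    using yz(1)[OF that] NL that by simp
  show "aggregates (cons_op A t)
      (image_mset (sent t) (mset_set (supernode_of G (FA t) u))) (fst (NL u ! t))" if "u \<in> V" for u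
    using yz(2)[OF that] NL that by simp
  show "aggregates_opt (agg_op A t)
       (image_mset (\<lambda>(e, u). agg_value A (eview \<omega> (c (Suc t)) e) u)
         (mset_set {(e, w). e \<in> minor_edges G (FA t) \<and>
           w \<in> e \<inter> supernode_of G (FA t) u})) (snd (NL u ! t))"
    if "u \<in> V" for u using yz(4)[OF that] NL that by simp
  show "EL e ! t = (if e \<in> minor_edges G (FA t) then (\<lambda>u. (u, fst (NL u ! t))) ` e else {})"
    if e: "e \<in> edges G" for e
  proof -
    have "EL e ! t = (if e \<in> minor_edges G (FA t) then (\<lambda>u. (u, y u)) ` e else {})"
      by (rule nth_last_of_take[of "elog (c t) e"]) (use elog_take[OF e] yz(3)[OF e] t in auto)
    moreover have "(\<lambda>u. (u, y u)) ` e = (\<lambda>u. (u, fst (NL u ! t))) ` e"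
    proof (rule image_cong[OF refl])
      fix u assume "u \<in> e"
      then have "u \<in> V" using e G by (auto simp: simple_graph_def V_def)
      then show "(u, y u) = (u, fst (NL u ! t))" by (simp add: NL)
    qed
    ultimately show ?thesis by simp
  qed
qed

lemma P_pos: "P > 0" by (simp add: phase_len_def)

lemma round_decoded:
  assumes "q * P + j < T" "j < P" "u \<in> V"
  shows "aggregates_opt (sub_op \<beta> (cons_op Av q) (agg_op Av q) j)
    (\<Sum>v\<in>supernode_of G (FA (q * P + j)) u. mset_opt (msg_opt (sent (q * P + j) v))) (decoded \<beta>
      (NL u) q j)"
proof -
  have "cons_op A (q * P + j) = lift_op (sub_op \<beta> (cons_op Av q) (agg_op Av q) j)"
    using assms(2) by (simp add: sim_alg_def)
  from aggregates_lift_op[OF round_facts(2)[OF assms(1,3), unfolded this]]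
  show ?thesis by (simp add: decoded_def multiset.map_comp comp_def sum_unfold_sum_mset)
qed

lemma supernode_full: "u \<in> V \<Longrightarrow> supernode_of G (edges G) u = V"
  using connected by (auto simp: supernode_of_def V_def connected_graph_def)

lemma storage:
  assumes "u \<in> V"
  shows "set (virt_ids (st u)) = W" "w \<in> W \<Longrightarrow> virt_input (st u) w = inp w"
    "virt_incident (st u) = {e \<in> virtual_edges G Gv. u \<in> e}"
    "virt_virt (st u) = {e \<in> virtual_edges G Gv. e \<subseteq> W}"
  using stored assms by (auto simp: distributedly_stored_def V_def W_def)

lemma past_index: "p < q \<Longrightarrow> i < P \<Longrightarrow> q * P \<le> t \<Longrightarrow> p * P + i < t"
proof -
  assume a: "p < q" "i < P" "q * P \<le> t"
  have "p * P + i < Suc p * P" using a by simp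
  also have "\<dots> \<le> q * P" using a(1) by (intro mult_le_mono1) simp
  finally show ?thesis using a by simp
qed

lemma decoded_take:
  assumes "p < q" "q * P \<le> t" "i < P"
  shows "decoded \<beta> (take t l) p i = decoded \<beta> l p i"
  using past_index[OF assms(1,3,2)] by (simp add: decoded_def)

lemma W_small: "finite W" "card W \<le> \<beta>" using finite_W card_virt by (auto simp: W_def)

lemma node_log_of_take:
  assumes "q * P \<le> t" shows "node_log_of \<beta> W (take t l) q = node_log_of \<beta> W l q"
  unfolding node_log_of_def
  using cons_result_cong[OF W_small, of "decoded \<beta> (take t l) _" "decoded \<beta> l _"]
    agg_result_cong[OF W_small, of "decoded \<beta> (take t l) _" "decoded \<beta> l _"]
    decoded_take[OF _ assms]
  by (intro ext map_cong refl) (simp add: phase_len_def)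

lemma virt_log_of_take:
  assumes "q * P \<le> t" shows "virt_log_of \<beta> W (take t l) q = virt_log_of \<beta> W l q"
  unfolding virt_log_of_def
  using virt_entry_cong[OF W_small, of "decoded \<beta> (take t l) _" "decoded \<beta> l _"]
    decoded_take[OF _ assms]
  by (intro ext map_cong refl) (simp add: phase_len_def)

lemma edge_log_of_take:
  assumes "q * P \<le> t" shows "edge_log_of \<beta> (take t l) q = edge_log_of \<beta> l q"
proof -
  have "take t l ! (p * P + i) = l ! (p * P + i)" if "p < q" "i < P" for p i
    using past_index[OF that assms] by simp
  from this[of _ 1] this[of _ "2 * \<beta> + 3"] show ?thesis unfolding edge_log_of_def
    by (intro map_cong refl arg_cong2[of _ _ _ _ real_entry]) (simp_all add: phase_len_def)
qed

lemma host_tape_node: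
  "u \<in> V \<Longrightarrow> v \<in> hosted_nodes G Gv ldr u \<Longrightarrow> (\<lambda>k. \<omega>' (Node v, k)) = ext (\<lambda>k. \<omega> (Node u, k)) (Node v)"
  using coins[of "Node v"] verts_Gv
  by (auto simp: hosted_nodes_def host_def units_def V_def W_def split: if_splits)

lemma host_tape_edge:
  assumes "u \<in> V" "e \<in> hosted_edges G Gv ldr u"
  shows "(\<lambda>k. \<omega>' (Edge e, k)) = ext (\<lambda>k. \<omega> (Node u, k)) (Edge e)"
proof -
  have e: "e \<in> edges Gv" "e \<notin> edges G" "e \<subseteq> insert u W"
    using hosted_edge_sub[OF assms(2,1)] by (auto simp: virtual_edges_def)
  have "host G ldr (Edge e) = Node u"
  proof (cases "u \<in> e")
    case True
    then have "e \<inter> V = {u}" using e assms verts_Gv(2) by auto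
    then show ?thesis using e by (simp add: host_def V_def)
  next
    case False
    then have "u = ldr" using assms(2) by (auto simp: hosted_edges_def split: if_splits)
    moreover have "e \<inter> V = {}" using False e verts_Gv(2) by auto
    ultimately show ?thesis using e by (simp add: host_def V_def)
  qed
  then show ?thesis using coins[of "Edge e"] e by (simp add: units_def)
qed

lemma real_edge_tape:
  "e \<in> edges G \<Longrightarrow> (\<lambda>k. \<omega>' (Edge e, k)) = ext (\<lambda>k. \<omega> (Edge e, k)) (Edge e)"
  using coins[of "Edge e"] edges_sub by (auto simp: units_def host_def)

text \<open>The invariant after \<open>q\<close> phases. Every node, not only the leader,
  reconstructs the logs of the virtual nodes; so it already contains the claim on what is learned in
  the end.\<close>

definition agrees :: "nat \<Rightarrow> config \<Rightarrow> bool" where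
  "agrees q cv \<longleftrightarrow>
     (\<forall>u\<in>V. \<forall>x\<in>insert u W. nlog cv x = node_log_of \<beta> W (NL u) q x) \<and>
     (\<forall>u\<in>V. \<forall>e\<in>virtual_edges G Gv. e \<subseteq> insert u W \<longrightarrow> elog cv e = virt_log_of \<beta> W (NL u) q e) \<and>
     (\<forall>e\<in>edges G. elog cv e = edge_log_of \<beta> (EL e) q)"

end

section \<open>One phase simulates one round\<close>

locale sim_step = sim_run +
  fixes q :: nat and cv :: config
  assumes agrees: "agrees q cv" and time: "Suc q * P \<le> T"
begin

definition "Fv = {e \<in> edges Gv. contracts Av (eview \<omega>' cv e)}"
definition "xv v = cons_value Av (nview inp \<omega>' cv v)"
definition "agv e S v = agg_value Av \<lparr>edge_ends = e, edge_tape = (\<lambda>k. \<omega>' (Edge e, k)),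
  edge_learned = elog cv e @ [S]\<rparr> v"
abbreviation "fc \<equiv> cons_op Av q"
abbreviation "fa \<equiv> agg_op Av q"
definition "Y u = decoded \<beta> (NL u) q"
definition "Zx u = edge_agg \<beta> (NL u) q"
abbreviation "msg_of \<equiv> phase_msg G Gv ldr \<beta> Fv xv agv fc fa Y Zx"

lemma time_lt: "j < P \<Longrightarrow> q * P + j < T" using time by simp

text \<open>An edge of \<open>G\<close> bases its choice on completed phases only, so the same parts
  are contracted in all three rounds.\<close>

lemma contracts_part:
  assumes "j \<in> {1, \<beta> + 2, 2 * \<beta> + 4}"
  shows "FA (q * P + j) = Fv \<inter> edges G"
proof -
  have j: "j < P" using assms by (auto simp: phase_len_def)
  have "contracts A (eview \<omega> (c (q * P + j)) e) = contracts Av (eview \<omega>' cv e)"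
    if e: "e \<in> edges G" for e
  proof -
    have "elog cv e = edge_log_of \<beta> (elog (c (q * P + j)) e) q"
      using agrees e edge_log_of_take[of q "q * P + j" "EL e"] elog_take(1)[OF e, of
        "q * P + j"] time_lt[OF j]
      by (simp add: agrees_def)
    then show ?thesis using assms j elog_take(2)[OF e, of
      "q * P + j"] time_lt[OF j] real_edge_tape[OF e]
      by (simp add: sim_alg_def eview_def Let_def)
  qed
  then show ?thesis using edges_sub by (auto simp: FA_def Fv_def)
qed

lemma contracts_full:
  assumes "j < P" "j \<notin> {1, \<beta> + 2, 2 * \<beta> + 3, 2 * \<beta> + 4}"
  shows "FA (q * P + j) = edges G"
  using assms elog_take(2)[of _ "q * P + j"] time_lt[of j]
  by (auto simp: FA_def sim_alg_def eview_def Let_def)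

lemma contracts_none: "FA (q * P + (2 * \<beta> + 3)) = {}"
  using elog_take(2)[of _ "q * P + (2 * \<beta> + 3)"] time_lt[of "2 * \<beta> + 3"]
  by (auto simp: FA_def sim_alg_def eview_def Let_def phase_len_def)

lemma sent_eq:
  assumes "j < P"
  shows "u \<in> V \<Longrightarrow> sent (q * P + j) u = take (3 * b + 4) (opt_msg (node_msg \<beta> ext Av
    (nview (\<lambda>u. (inp u, st u)) \<omega> (c (q * P + j)) u) q j))"
  using nlog_take(2)[of u "q * P + j"] time_lt[OF assms] assms
  by (simp add: sent_def sim_alg_def Let_def nview_def)

lemma leader_elected:
  assumes u: "u \<in> V" shows "Y u 0 = Some ldr"
proof -
  have "msg_opt (sent (q * P + 0) v) = Some v" if "v \<in> V" for v
  proof -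
    have "length v \<le> b" using ids[of v] that verts_Gv by auto
    moreover have "sent (q * P + 0) v = take (3 * b + 4) (opt_msg (Some v))"
      using sent_eq[of 0, OF P_pos that] by (simp add: node_msg_def sub_msg_def nview_def)
    ultimately show ?thesis by (simp add: opt_msg_def)
  qed
  then have "(\<Sum>v\<in>V. mset_opt (msg_opt (sent (q * P + 0) v))) = (\<Sum>v\<in>V. {#v#})"
    by (intro sum.cong) auto
  moreover have "FA (q * P + 0) = edges G" using contracts_full[OF P_pos] by simp
  ultimately have "aggregates_opt min_id (mset_set V) (Y u 0)"
    using round_decoded[OF time_lt[OF P_pos] P_pos u] supernode_full[OF u]
    by (simp add: sub_op_def Y_def)
  moreover have "mset_set V \<noteq> {#}" using finite_V u by (auto simp: mset_set_empty_iff)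
  ultimately obtain m where m: "Y u 0 = Some m" "aggregates min_id (mset_set V) m"
    by (cases "Y u 0") (auto simp: aggregates_opt_def)
  from aggregates_min_id[OF m(2)] have "m \<in> V" "to_nat m \<le> to_nat ldr"
    using finite_V ldr by auto
  then have "m = ldr" using ldr_min[of m] by (simp add: V_def)
  then show ?thesis using m by simp
qed

lemma node_msg_eq:
  assumes u: "u \<in> V" and j: "j < P"
  shows "node_msg \<beta> ext Av (nview (\<lambda>u. (inp u, st u)) \<omega> (c (q * P + j)) u) q j = msg_of u j"
\<comment> \<open>In round 0 the leader of the phase is not logged yet, so a node cannot tell which
  units it runs; its message is its ID in any case.\<close>
proof (cases "j = 0")
  case True
  then show ?thesis by (simp add: node_msg_def phase_msg_def sub_msg_def nview_def)
next
  case False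
  define t where "t = q * P + j"
  have tT: "t < T" using time_lt[OF j] by (simp add: t_def)
  have log: "nlog (c t) u = take t (NL u)" using nlog_take(1)[OF u] tT by auto
  have ys: "decoded \<beta> (take t (NL u)) q i = Y u i" if "i < j" for i
    using that by (simp add: decoded_def Y_def t_def)
  then have y0: "decoded \<beta> (take t (NL u)) q 0 = Some ldr" using False leader_elected[OF u] by simp
  let ?Hn = "hosted_nodes G Gv ldr u" and ?He = "hosted_edges G Gv ldr u"
  have Hn: "insert u (if Some ldr = Some u then W else {}) = ?Hn"
    by (auto simp: hosted_nodes_def W_def)
  have He: "virt_incident (st u) \<union> (if Some ldr = Some u then virt_virt (st u) else {}) = ?He"
    using storage(3,4)[OF u] by (auto simp: hosted_edges_def W_def)
  have vl: "virt_log_of \<beta> W (take t (NL u)) q e = elog cv e" if "e \<in> ?He" for e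
    using virt_log_of_take[of q t "NL u"] agrees hosted_edge_sub[OF that u] u
    by (simp add: agrees_def t_def)
  have nl: "node_log_of \<beta> W (take t (NL u)) q v = nlog cv v" if "v \<in> ?Hn" for v
    using node_log_of_take[of q t "NL u"] agrees u that
    by (auto simp: agrees_def t_def hosted_nodes_def W_def split: if_splits)
  have tp: "ext (\<lambda>k. \<omega> (Node u, k)) (Edge e) = (\<lambda>k. \<omega>' (Edge e, k))" if "e \<in> ?He" for e
    using host_tape_edge[OF u that] by simp
  have K: "{e \<in> ?He. contracts Av \<lparr>edge_ends = e, edge_tape = ext (\<lambda>k. \<omega> (Node u, k)) (Edge e),
     edge_learned = virt_log_of \<beta> W (take t (NL u)) q e\<rparr>} = Fv \<inter> ?He"
    using vl tp hosted_edge_sub[OF _ u] by (auto simp: Fv_def eview_def)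
  have x: "cons_value Av \<lparr>node_id = v, node_input = if v = u then inp u else virt_input (st u) v,
             node_tape = ext (\<lambda>k. \<omega> (Node u, k)) (Node v), node_learned =
               node_log_of \<beta> W (take t (NL u)) q v\<rparr> = xv v"
    if "v \<in> ?Hn" for v
  proof -
    have "(if v = u then inp u else virt_input (st u) v) = inp v"
      using that storage(2)[OF u, of v] by (auto simp: hosted_nodes_def W_def split: if_splits)
    then show ?thesis using nl[OF that] host_tape_node[OF u that] by (simp add: xv_def nview_def)
  qed
  have a: "agg_value Av \<lparr>edge_ends = e, edge_tape = ext (\<lambda>k. \<omega> (Node u, k)) (Edge e),
             edge_learned = virt_log_of \<beta> W (take t (NL u)) q e @ [S]\<rparr> v =
               agv e S v" if "e \<in> ?He" for e S v
    using vl[OF that] tp[OF that] by (simp add: agv_def)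
  have zx: "edge_agg \<beta> (take t (NL u)) q = Zx u" if "j > 2 * \<beta> + 3"
    using that by (simp add: edge_agg_def Zx_def t_def)
  have "node_msg \<beta> ext Av (nview (\<lambda>u. (inp u, st u)) \<omega> (c t) u) q j =
    sub_msg \<beta> W u ?Hn ?He (Fv \<inter> ?He)
      (\<lambda>v. cons_value Av \<lparr>node_id = v, node_input = if v = u then inp u else virt_input (st u) v,
             node_tape = ext (\<lambda>k. \<omega> (Node u, k)) (Node v), node_learned =
               node_log_of \<beta> W (take t (NL u)) q v\<rparr>)
      (\<lambda>e S v. agg_value Av \<lparr>edge_ends = e, edge_tape = ext (\<lambda>k. \<omega> (Node u, k)) (Edge e),
             edge_learned = virt_log_of \<beta> W (take t (NL u)) q e @ [S]\<rparr> v)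
      fc fa (decoded \<beta> (take t (NL u)) q) (edge_agg \<beta> (take t (NL u)) q) j"
    unfolding node_msg_def Let_def nview_def node_view.simps log fst_conv snd_conv storage(1)[OF u]
      y0 Hn He K ..
  also have "\<dots> = sub_msg \<beta> W u ?Hn ?He (Fv \<inter> ?He) xv agv fc fa (Y u) (Zx u) j"
    by (rule sub_msg_cong[OF W_small]) (use ys zx x a in auto)
  finally show ?thesis by (simp add: phase_msg_def t_def W_def)
qed

lemma Av_bounds: "length (cons_value Av w) \<le> b" "length (agg_value Av w' v) \<le> b"
  "length (cons_op Av t m m') \<le> b" "length (agg_op Av t m m') \<le> b"
  using bounded ops by (auto simp: bit_bounded_def ops_bounded_def)

lemma agg_round:
  assumes u: "u \<in> V"
  shows "aggregates_opt fa (\<Sum>e\<in>{e \<in> edges G. u \<in> e}.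
    mset_opt (msg_opt (agg_value A (eview \<omega> (c (Suc (q * P + (2 * \<beta> + 3)))) e) u))) (Zx u)"
proof -
  let ?t = "q * P + (2 * \<beta> + 3)" let ?E = "{e \<in> edges G. u \<in> e}"
  have j: "2 * \<beta> + 3 < P" by (simp add: phase_len_def)
  have sn: "supernode_of G {} u = {u}" using u by (auto simp: supernode_of_def link_def V_def)
  have me: "minor_edges G {} = edges G"
    using G by (auto simp: minor_edges_def supernodes_def supernode_of_def link_def
      simple_graph_def card_2_iff subset_iff)
      (metis insertCI)
  have "agg_op A ?t = lift_op fa" using j by (simp add: sim_alg_def)
  from aggregates_opt_lift_op[OF round_facts(4)[OF time_lt[OF j] u, unfolded this]]
  have 1: "aggregates_opt fa (\<Sum>p\<in>{(e, w). e \<in> edges G \<and>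
    w \<in> e \<inter> {u}}. mset_opt (msg_opt (case p of (e, u) \<Rightarrow> agg_value A (eview \<omega> (c (Suc ?t)) e) u)))
      (Zx u)"
    unfolding contracts_none sn me
    by (simp add: Zx_def edge_agg_def multiset.map_comp comp_def sum_unfold_sum_mset)
  have "{(e, w). e \<in> edges G \<and> w \<in> e \<inter> {u}} = (\<lambda>e. (e, u)) ` ?E" by auto
  then show ?thesis using 1 by (simp add: sum.reindex inj_on_def)
qed

lemma Zx_length: "u \<in> V \<Longrightarrow> Zx u = Some m \<Longrightarrow> length m \<le> b"
proof -
  assume "u \<in> V" "Zx u = Some m"
  moreover have "length p \<le> b" if "p \<in># (\<Sum>e\<in>{e \<in> edges G. u \<in> e}.
    mset_opt (msg_opt (agg_value A (eview \<omega> (c (Suc (q * P + (2 * \<beta> + 3)))) e) u)))" for p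
  proof -
    from sum_mset_opt_in[OF that] obtain e where
      "msg_opt (agg_value A (eview \<omega> (c (Suc (q * P + (2 * \<beta> + 3)))) e) u) = Some p" by auto
    then show ?thesis using Av_bounds(2) by (auto simp: sim_alg_def Let_def split: if_splits)
  qed
  ultimately show ?thesis
    using aggregates_opt_closed[OF agg_round, of u "\<lambda>p. length p \<le> b" fa] Av_bounds(4) by auto
qed

text \<open>\<open>3 * b + 1\<close> bits and the presence bit fit, so \<open>take\<close> cuts
  nothing off.\<close>

lemma sent_exact:
  assumes u: "u \<in> V" and j: "j < P" "j \<noteq> 2 * \<beta> + 3"
  shows "sent (q * P + j) u = opt_msg (msg_of u j)"
proof -
  have "length (opt_msg (msg_of u j)) \<le> 3 * b + 4"
  proof (cases "msg_of u j")
    case (Some m)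
    have "length m \<le> 3 * b + 1"
      by (rule sub_msg_length[OF j(2) Some[unfolded phase_msg_def]])
        (use u ids verts_Gv Av_bounds Zx_length in \<open>auto simp: xv_def agv_def W_def[symmetric]\<close>)
    then show ?thesis using Some by (simp add: opt_msg_def)
  qed (simp add: opt_msg_def)
  then show ?thesis using sent_eq[OF j(1) u] node_msg_eq[OF u j(1)] by simp
qed

lemma round_sum:
  assumes u: "u \<in> V" and j: "j < P" "j \<noteq> 2 * \<beta> + 3"
  shows "aggregates_opt (sub_op \<beta> fc fa j)
    (\<Sum>v\<in>supernode_of G (FA (q * P + j)) u. mset_opt (msg_of v j)) (Y u j)"
proof -
  have "(\<Sum>v\<in>supernode_of G (FA (q * P + j)) u. mset_opt (msg_opt (sent (q * P + j) v))) =
    (\<Sum>v\<in>supernode_of G (FA (q * P + j)) u. mset_opt (msg_of v j))"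
    by (rule sum.cong) (use sent_exact[OF _ j] in \<open>auto simp: supernode_of_def V_def\<close>)
  then show ?thesis using round_decoded[OF time_lt[OF j(1)] j(1) u] by (simp add: Y_def)
qed

text \<open>\<open>phase\<close> exempts the exchange round. This avoids a circle, since the length
  of the messages of that round is bounded through consequences of \<open>phase\<close>.\<close>

sublocale ph: phase G Gv ldr \<beta> Fv xv agv fc fa Y Zx
proof unfold_locales
  show "card (virtual_nodes G Gv) \<le> \<beta>" by (rule card_virt)
  show "Fv \<subseteq> edges Gv" by (auto simp: Fv_def)
next
  fix j u v assume a: "j \<in> {1, \<beta> + 2, 2 * \<beta> + 4}" "u \<in> verts G" "v \<in> verts G"
    "(u, v) \<in> (link (Fv \<inter> edges G))\<^sup>*"
  then have "j < P" by (auto simp: phase_len_def)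
  then show "Y u j = Y v j" using round_facts(1)[OF time_lt, of j u v] contracts_part[OF a(1)] a
    by (simp add: Y_def decoded_def V_def)
next
  fix j u assume a: "j \<in> {1, \<beta> + 2, 2 * \<beta> + 4}" "u \<in> verts G"
  then have "j < P" "j \<noteq> 2 * \<beta> + 3" by (auto simp: phase_len_def)
  then show "aggregates_opt (sub_op \<beta> fc fa j)
     (\<Sum>v\<in>supernode_of G (Fv \<inter> edges G) u. mset_opt (msg_of v j)) (Y u j)"
    using round_sum[of u j] contracts_part[OF a(1)] a by (simp add: V_def)
next
  fix j u v assume a: "j < 3 * \<beta> + 5" "j \<notin> {1, \<beta> + 2, 2 * \<beta> + 3, 2 * \<beta> + 4}" "u \<in> verts G"
    "v \<in> verts G"
  then have j: "j < P" by (auto simp: phase_len_def)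
  have "(u, v) \<in> (link (edges G))\<^sup>*" using connected a by (auto simp: connected_graph_def)
  then show "Y u j = Y v j" using round_facts(1)[OF time_lt[OF j], of u v] contracts_full[OF j
    a(2)] a
    by (simp add: Y_def decoded_def V_def)
next
  fix j u assume a: "j < 3 * \<beta> + 5" "j \<notin> {1, \<beta> + 2, 2 * \<beta> + 3, 2 * \<beta> + 4}" "u \<in> verts G"
  then have j: "j < P" "j \<noteq> 2 * \<beta> + 3" by (auto simp: phase_len_def)
  then show "aggregates_opt (sub_op \<beta> fc fa j) (\<Sum>v\<in>verts G. mset_opt (msg_of v j)) (Y u j)"
    using round_sum[of u j] contracts_full[OF j(1) a(2)] a supernode_full[of u] by (simp add: V_def)
qed

lemma y_length: "w \<in> verts Gv \<Longrightarrow> length (ph.y w) \<le> b"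
  using aggregates_closed[OF ph.y_agg, of w "\<lambda>p. length p \<le> b" fc] Av_bounds finite_Gv
  by (auto simp: xv_def)

text \<open>Nothing is cut off because labels are IDs of virtual nodes and the consensus value is an
  aggregate of short messages.\<close>

lemma sent_exchange:
  assumes u: "u \<in> V"
  shows "sent (q * P + (2 * \<beta> + 3)) u = True # pair_msg (opt_msg (label_of \<beta> W (Y u) u))
    (cons_result \<beta> W (Y u) u)"
proof -
  have j: "2 * \<beta> + 3 < P" by (simp add: phase_len_def)
  have uv: "u \<in> verts Gv" using u verts_Gv by auto
  have "msg_of u (2 * \<beta> + 3) = Some (pair_msg (opt_msg (label_of \<beta> W (Y u) u)) (cons_result \<beta> W
    (Y u) u))"
    by (simp add: phase_msg_def sub_msg_def W_def)
  then have s: "sent (q * P + (2 * \<beta> + 3)) u = take (3 * b + 4)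
      (True # pair_msg (opt_msg (label_of \<beta> W (Y u) u)) (cons_result \<beta> W (Y u) u))"
    using sent_eq[OF j u] node_msg_eq[OF u j] by (simp add: opt_msg_def[of "Some _"])
  have "length (cons_result \<beta> W (Y u) u) \<le> b" using ph.cons_result_eq[OF u, of u] y_length[OF uv]
    by simp
  moreover have "length (opt_msg (label_of \<beta> W (Y u) u)) \<le> Suc b"
  proof (cases "ph.Lam u")
    case (Some l)
    then have "l \<in> verts Gv" using ph.Lam_rep[OF uv] verts_Gv by auto
    then show ?thesis using ids[of l] Some ph.label_of_eq[OF u, of u] by (simp add: opt_msg_def)
  qed (use ph.label_of_eq[OF u, of u] in \<open>simp add: opt_msg_def\<close>)
  ultimately show ?thesis unfolding s by (intro take_all) simp
qed

lemma edge_entry: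
  assumes e: "e \<in> edges G"
  shows "real_entry (EL e ! (q * P + 1)) (EL e ! (q * P + (2 * \<beta> + 3))) = ph.entG e"
proof -
  let ?t = "q * P + (2 * \<beta> + 3)"
  have j: "2 * \<beta> + 3 < P" "1 < P" by (auto simp: phase_len_def)
  have eV: "e \<subseteq> V" "e \<noteq> {}" "card e = 2" using e G by (auto simp: simple_graph_def V_def)
  have 1: "EL e ! (q * P + 1) \<noteq> {} \<longleftrightarrow> e \<in> minor_edges G ph.F"
    using round_facts(3)[OF time_lt[OF j(2)] e] contracts_part[of 1] eV by (simp add: ph.F_def)
  have "fst (NL u ! ?t) = sent ?t u" if "u \<in> V" for u
  proof -
    have "supernode_of G {} u = {u}" using that by (auto simp: supernode_of_def link_def V_def)
    then show ?thesis
      using round_facts(2)[OF time_lt[OF j(1)] that] contracts_none aggregates_singleton by auto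
  qed
  moreover have "e \<in> minor_edges G {}"
    using e eV by (auto simp: minor_edges_def supernodes_def supernode_of_def link_def card_2_iff)
  ultimately have 2: "EL e ! ?t = (\<lambda>u. (u, True # pair_msg (opt_msg (label_of \<beta> W (Y u) u))
    (cons_result \<beta> W (Y u) u))) ` e"
    using round_facts(3)[OF time_lt[OF j(1)] e] contracts_none sent_exchange eV
    by (auto intro!: image_cong)
  show ?thesis unfolding real_entry_def 1 2 ph.entG_def
    by (intro if_cong) (auto simp: image_image)
qed

sublocale px: phase_exchange G Gv ldr \<beta> Fv xv agv fc fa Y Zx
proof unfold_locales
  fix u assume "u \<in> verts G"
  then have u: "u \<in> V" by (simp add: V_def)
  let ?t = "q * P + (2 * \<beta> + 3)"
  have j: "2 * \<beta> + 3 < P" by (simp add: phase_len_def)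
  have fin: "finite {e \<in> edges G. u \<in> e}" using finite_edges edges_sub
    by (auto intro: finite_subset)
  have "msg_opt (agg_value A (eview \<omega> (c (Suc ?t)) e) u) =
      (if ph.entG e \<noteq> {} then Some (agv e (ph.entG e) u) else None)" if e: "e \<in> edges G" for e
  proof -
    have l: "elog (c (Suc ?t)) e = take (Suc ?t) (EL e)" "length (elog (c (Suc ?t)) e) = Suc ?t"
      using elog_take[OF e, of "Suc ?t"] time_lt[OF j] by auto
    have n: "take (Suc ?t) (EL e) ! (q * P + 1) = EL e ! (q * P + 1)"
      "take (Suc ?t) (EL e) ! ?t = EL e ! ?t" by auto
    \<comment> \<open>Phase \<open>q\<close> is still running, but its entry reads only the
      positions 1 and \<open>2 * \<beta> + 3\<close>, both already logged.\<close>
    have "edge_log_of \<beta> (take (Suc ?t) (EL e)) (Suc q) =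
      edge_log_of \<beta> (take (Suc ?t) (EL e)) q @ [ph.entG e]"
      using edge_entry[OF e] n by (simp add: edge_log_of_def)
    also have "edge_log_of \<beta> (take (Suc ?t) (EL e)) q = elog cv e"
      using edge_log_of_take[of q "Suc ?t" "EL e"] agrees e by (simp add: agrees_def)
    finally have el: "edge_log_of \<beta> (elog (c (Suc ?t)) e) (Suc q) = elog cv e @ [ph.entG e]"
      unfolding l(1) .
    have "?t div P = q" "?t mod P = 2 * \<beta> + 3" using j by auto
    then show ?thesis using real_edge_tape[OF e]
      unfolding sim_alg_def ma_algorithm.simps Let_def eview_def edge_view.simps l(2) diff_Suc_1
      by (simp only: el last_snoc agv_def) simp
  qed
  then have "(\<Sum>e\<in>{e \<in> edges G. u \<in> e}. mset_opt (msg_opt (agg_value A (eview \<omega> (c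
    (Suc ?t)) e) u))) =
    (\<Sum>e\<in>{e \<in> edges G. u \<in> e}. mset_opt (if ph.entG e \<noteq>
      {} then Some (agv e (ph.entG e) u) else None))"
    by (intro sum.cong) auto
  also have "\<dots> = image_mset (\<lambda>e. agv e (ph.entG e) u)
    (mset_set {e \<in> {e \<in> edges G. u \<in> e}. ph.entG e \<noteq> {}})"
    by (rule sum_mset_opt_if[OF fin])
  also have "{e \<in> {e \<in> edges G. u \<in> e}. ph.entG e \<noteq> {}} = {e \<in> edges G. u \<in> e \<and> ph.entG e \<noteq> {}}"
    by auto
  finally show "aggregates_opt fa (image_mset (\<lambda>e. agv e (ph.entG e) u)
      (mset_set {e \<in> edges G. u \<in> e \<and> ph.entG e \<noteq> {}})) (Zx u)"
    using agg_round[OF u] by simp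
qed

definition "cv' = \<lparr>nlog = (\<lambda>w. nlog cv w @ [(ph.y w, ph.z w)]), elog =
  (\<lambda>e. elog cv e @ [ph.ent e])\<rparr>"

lemma Av_round: "ma_round Av Gv inp \<omega>' q cv cv'"
proof (rule ma_roundI[OF simple_Gv, where y = ph.y and z = ph.z], unfold Fv_def[symmetric])
  fix w assume w: "w \<in> verts Gv"
  show "aggregates fc (image_mset (\<lambda>v. cons_value Av (nview inp \<omega>' cv v)) (mset_set
    (supernode_of Gv Fv w))) (ph.y w)"
    using ph.y_agg[OF w] by (simp add: xv_def[abs_def])
  have "agg_value Av (eview \<omega>' cv' e) u = agv e (ph.ent e) u" for e u
    by (simp add: eview_def agv_def cv'_def)
  then show "aggregates_opt fa (image_mset (\<lambda>(e, u). agg_value Av (eview \<omega>' cv' e) u)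
     (mset_set {(e, u). e \<in> minor_edges Gv Fv \<and> u \<in> e \<inter> supernode_of Gv Fv w})) (ph.z w)"
    using px.z_agg[OF w] by simp
next
  fix u v assume "u \<in> verts Gv" "v \<in> verts Gv" "(u, v) \<in> (link Fv)\<^sup>*"
  then show "ph.y u = ph.y v \<and> ph.z u = ph.z v" by (rule ph.yz_const)
qed (simp_all add: cv'_def ph.ent_def)

lemma agrees_next: "agrees (Suc q) cv'"
  unfolding agrees_def
proof (intro conjI ballI impI)
  fix u w assume u: "u \<in> V" "w \<in> insert u W"
  have "nlog cv w = node_log_of \<beta> W (NL u) q w" using agrees u unfolding agrees_def by blast
  then show "nlog cv' w = node_log_of \<beta> W (NL u) (Suc q) w"
    using ph.cons_result_eq[OF u] ph.agg_result_eq[OF u]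
    by (simp add: cv'_def node_log_of_def Y_def)
next
  fix u e assume u: "u \<in> V" "e \<in> virtual_edges G Gv" "e \<subseteq> insert u W"
  have "e \<in> edges Gv" using u by (simp add: virtual_edges_def)
  moreover have "elog cv e = virt_log_of \<beta> W (NL u) q e" using agrees u unfolding agrees_def
    by blast
  ultimately show "elog cv' e = virt_log_of \<beta> W (NL u) (Suc q) e"
    using ph.virt_entry_eq[OF u(1) _ u(2,3)] by (simp add: cv'_def virt_log_of_def Y_def)
next
  fix e assume e: "e \<in> edges G"
  then show "elog cv' e = edge_log_of \<beta> (EL e) (Suc q)"
    using agrees edge_entry[OF e] ph.entG_eq[OF e] by (simp add: cv'_def edge_log_of_def agrees_def)
qed

end

lemma (in sim_run) simulation:
  "q * P \<le> T \<Longrightarrow> \<exists>cv. reaches Av Gv inp \<omega>' q cv \<and> agrees q cv"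
proof (induction q)
  case 0
  show ?case
    by (intro exI conjI, rule reaches.start)
      (simp add: agrees_def node_log_of_def virt_log_of_def edge_log_of_def)
next
  case (Suc q)
  then obtain cv where cv: "reaches Av Gv inp \<omega>' q cv" "agrees q cv" by auto
  interpret sim_step G Gv ldr Av \<beta> b ext inp st \<omega> \<omega>' c T q cv
    by unfold_locales (use cv Suc.prems in auto)
  show ?case using reaches.step[OF cv(1) Av_round] agrees_next by blast
qed

subsection \<open>Bounds, coins and the theorem\<close>

text \<open>The operators of a \<open>b\<close>-bounded algorithm may return long messages on long arguments,
  which never occur in its runs but count when the simulating algorithm has to be bounded.\<close>

definition trunc_ops :: "nat \<Rightarrow> 'i ma_algorithm \<Rightarrow> 'i ma_algorithm" where
  "trunc_ops b A = A\<lparr>cons_op := \<lambda>t x y. take b (cons_op A t x y), agg_op := \<lambda>t x y. take b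
    (agg_op A t x y)\<rparr>"

lemma trunc_ops_simps [simp]:
  "rounds (trunc_ops b A) = rounds A" "contracts (trunc_ops b A) = contracts A"
  "cons_value (trunc_ops b A) = cons_value A" "agg_value (trunc_ops b A) = agg_value A"
  "cons_op (trunc_ops b A) t = (\<lambda>x y. take b (cons_op A t x y))"
  "agg_op (trunc_ops b A) t = (\<lambda>x y. take b (agg_op A t x y))"
  by (simp_all add: trunc_ops_def)

lemma bounded_trunc_ops: "bit_bounded b A \<Longrightarrow> bit_bounded b (trunc_ops b A)" "ops_bounded b
  (trunc_ops b A)"
  by (auto simp: bit_bounded_def ops_bounded_def)

text \<open>All messages sent have length at most \<open>b\<close> and the operators of a bounded
  algorithm keep it so; there truncation is the identity.\<close>

lemma ma_round_trunc_ops: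
  assumes "bit_bounded b A" "ma_round (trunc_ops b A) G inp \<omega> t c c'"
  shows "ma_round A G inp \<omega> t c c'"
proof -
  have c: "aggregates (cons_op A t) M m" if "aggregates (\<lambda>x y. take b (cons_op A t x y)) M m"
    "\<And>x. x \<in># M \<Longrightarrow> length x \<le> b" for M m
    using aggregates_closed[OF that(1), of "\<lambda>x. length x \<le> b" "cons_op A t"] that(2) assms(1)
    by (auto simp: bit_bounded_def)
  have a: "aggregates_opt (agg_op A t) M m" if "aggregates_opt (\<lambda>x y. take b (agg_op A t x y)) M m"
    "\<And>x. x \<in># M \<Longrightarrow> length x \<le> b" for M m
    using aggregates_opt_closed[OF that(1), of "\<lambda>x. length x \<le> b" "agg_op A t"] that(2) assms(1)
    by (auto simp: bit_bounded_def)
  have lc: "length x \<le> b" if "x \<in># image_mset (\<lambda>v. cons_value A (nview inp \<omega> c v)) M" for x M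
    using that assms(1) by (auto simp: bit_bounded_def)
  have la: "length x \<le> b" if "x \<in># image_mset (\<lambda>(e, u). agg_value A (eview \<omega> c' e) u) M" for x M
    using that assms(1) by (auto simp: bit_bounded_def)
  let ?F = "{e \<in> edges G. contracts A (eview \<omega> c e)}"
  from assms(2) obtain y z where
    "\<forall>s\<in>supernodes G ?F. aggregates (\<lambda>x y. take b (cons_op A t x y))
       (image_mset (\<lambda>v. cons_value A (nview inp \<omega> c v)) (mset_set s)) (y s)"
    "\<forall>e\<in>edges G. elog c' e = elog c e @
       [if e \<in> minor_edges G ?F then (\<lambda>u. (u, y (supernode_of G ?F u))) ` e else {}]"
    "\<forall>s\<in>supernodes G ?F. aggregates_opt (\<lambda>x y. take b (agg_op A t x y))
       (image_mset (\<lambda>(e, u). agg_value A (eview \<omega> c' e) u)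
         (mset_set {(e, u). e \<in> minor_edges G ?F \<and> u \<in> e \<inter> s})) (z s)"
    "\<forall>v\<in>verts G. nlog c' v = nlog c v @ [(y (supernode_of G ?F v), z (supernode_of G ?F v))]"
    unfolding ma_round_def trunc_ops_simps Let_def by blast
  then show ?thesis unfolding ma_round_def Let_def
    by (intro exI[of _ y] exI[of _ z] conjI ballI c[OF _ lc] a[OF _ la]) auto
qed

lemma reaches_trunc_ops:
  assumes "bit_bounded b A" shows "reaches (trunc_ops b A) G inp \<omega> t c \<Longrightarrow> reaches A G inp \<omega> t c"
  by (induction rule: reaches.induct) (auto intro: reaches.intros ma_round_trunc_ops[OF assms])

lemma reaches_deterministic:
  assumes "deterministic A" shows "reaches A G inp \<omega> t c \<Longrightarrow> reaches A G inp \<omega>' t c"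
proof (induction rule: reaches.induct)
  case (step t c c')
  have 1: "contracts A (eview \<omega> c e) = contracts A (eview \<omega>' c e)" for e c
    using assms unfolding deterministic_def eview_def by (metis edge_view.update_convs(2))
  have 2: "cons_value A (nview inp \<omega> c v) = cons_value A (nview inp \<omega>' c v)" for v c
    using assms unfolding deterministic_def nview_def by (metis node_view.update_convs(3))
  have 3: "agg_value A (eview \<omega> c e) u = agg_value A (eview \<omega>' c e) u" for e c u
    using assms unfolding deterministic_def eview_def by (metis edge_view.update_convs(2))
  have "ma_round A G inp \<omega>' t c c'" using step.hyps(2) unfolding ma_round_def 1 2 3 .
  with step.IH show ?case by (rule reaches.step)
qed (rule reaches.start)

lemma reaches_sequence:
  assumes "reaches A G inp \<omega> T cT"
  shows "\<exists>c. c 0 = \<lparr>nlog = (\<lambda>_. []), elog = (\<lambda>_. [])\<rparr> \<and> c T = cT \<and>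
    (\<forall>t<T. ma_round A G inp \<omega> t (c t) (c (Suc t)))"
  using assms
proof (induction rule: reaches.induct)
  case (step t c c')
  then obtain f where f: "f 0 = \<lparr>nlog = (\<lambda>_. []), elog = (\<lambda>_. [])\<rparr>" "f t = c"
    "\<forall>s<t. ma_round A G inp \<omega> s (f s) (f (Suc s))" by auto
  then show ?case using step.hyps(2)
    by (intro exI[of _ "f(Suc t := c')"]) (auto simp: less_Suc_eq)
qed auto

section \<open>Coins of the virtual graph from coins of \<open>G\<close>\<close>

definition unit_code :: "unit_of_computation \<Rightarrow> nat" where
  "unit_code = to_nat_on (range Node \<union> Edge ` {e. finite e})"

text \<open>There are uncountably many sets of nodes but only countably many finite ones, and edges
  are finite.\<close>

lemma inj_unit_code: "inj_on unit_code (range Node \<union> Edge ` {e. finite e})"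
  unfolding unit_code_def
  by (intro inj_on_to_nat_on countable_Un countable_image countable_Collect_finite) auto

definition split_tape :: tape_split where
  "split_tape r x = (\<lambda>k. r (prod_encode (unit_code x, k)))"

definition coin_map :: "graph \<Rightarrow> graph \<Rightarrow> node \<Rightarrow> coins \<Rightarrow> coins" where
  "coin_map G Gv ldr \<omega> = (\<lambda>(x, k)\<in>units Gv \<times> UNIV. \<omega> (host G ldr x, prod_encode (unit_code x, k)))"

text \<open>Restricting a product of identical probability measures along an injection of index sets
  gives such a product again.\<close>

lemma coin_map:
  assumes "simple_graph Gv" "ldr \<in> verts G"
  shows "coin_map G Gv ldr \<in> coin_space G \<rightarrow>\<^sub>M coin_space Gv"
    and "distr (coin_space G) (coin_space Gv) (coin_map G Gv ldr) = coin_space Gv"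
proof -
  let ?M = "\<lambda>_ :: unit_of_computation \<times> nat. measure_pmf (pmf_of_set (UNIV :: bool set))"
  let ?f = "\<lambda>(x, k). (host G ldr x, prod_encode (unit_code x, k))"
  have "\<forall>e\<in>edges Gv. finite e" using assms(1) by (auto simp: simple_graph_def intro: finite_subset)
  then have "units Gv \<subseteq> range Node \<union> Edge ` {e. finite e}" by (auto simp: units_def)
  then have inj: "inj_on unit_code (units Gv)" using inj_unit_code inj_on_subset by blast
  \<comment> \<open>The second component alone recovers \<open>x\<close> and \<open>k\<close>, so
    different units may share a host.\<close>
  have inj_f: "inj_on ?f (units Gv \<times> UNIV)"
    using inj by (auto simp: inj_on_def)
  have "host G ldr x \<in> units G" if "x \<in> units Gv" for x
  proof (cases x)
    case (Edge e)
    have "(SOME u. u \<in> e \<inter> verts G) \<in> e \<inter> verts G" if "e \<inter> verts G \<noteq> {}"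
      by (rule someI_ex) (use that in auto)
    then show ?thesis using Edge assms(2) by (auto simp: host_def units_def)
  qed (use assms(2) in \<open>auto simp: host_def units_def\<close>)
  then have f: "?f \<in> units Gv \<times> UNIV \<rightarrow> units G \<times> UNIV" by auto
  have cm: "coin_map G Gv ldr = (\<lambda>\<omega>. \<lambda>i\<in>units Gv \<times> UNIV. \<omega> (?f i))"
    by (auto simp: coin_map_def fun_eq_iff restrict_def)
  show "coin_map G Gv ldr \<in> coin_space G \<rightarrow>\<^sub>M coin_space Gv"
    unfolding cm coin_space_def
    by (intro measurable_restrict measurable_component_singleton funcset_mem[OF f])
  show "distr (coin_space G) (coin_space Gv) (coin_map G Gv ldr) = coin_space Gv"
    unfolding cm coin_space_def
    using distr_PiM_reindex[of "units G \<times> UNIV" ?M ?f "units Gv \<times> UNIV"] inj_f f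
    by (simp add: prob_space_measure_pmf)
qed

lemma soft_O_one_linear:
  assumes "soft_O_one B" shows "soft_O_one (\<lambda>n. 3 * B n + 4)"
proof -
  from assms obtain k where k: "(\<lambda>n. real (B n)) \<in> O(\<lambda>n. ln (real n) ^ k)"
    by (auto simp: soft_O_one_def)
  \<comment> \<open>From 3 on the logarithm is at least 1, so each of its powers absorbs the
    constant 4.\<close>
  have "eventually (\<lambda>n. ln (real n) \<ge> 1) at_top"
    by (rule eventually_sequentiallyI[of 3]) (use ln3_gt_1 in \<open>auto intro: order_trans[of 1
      "ln 3"]\<close>)
  then have "eventually (\<lambda>n. norm (4 :: real) \<le> 4 * norm (ln (real n) ^ k)) at_top"
    by eventually_elim simp
  then have "(\<lambda>_. 4 :: real) \<in> O(\<lambda>n. ln (real n) ^ k)" by (rule bigoI)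
  then have "(\<lambda>n. 3 * real (B n) + 4) \<in> O(\<lambda>n. ln (real n) ^ k)"
    using k by (intro sum_in_bigo) auto
  then show ?thesis unfolding soft_O_one_def by (intro exI[of _ k]) simp
qed

text \<open>For a deterministic algorithm the simulation hands out constant tapes instead of real
  ones.\<close>

lemma deterministic_sim_alg: "deterministic (sim_alg \<beta> b (\<lambda>_ _ _. False) Av)"
proof -
  have "node_msg \<beta> (\<lambda>_ _ _. False) Av (w\<lparr>node_tape := r\<rparr>) q j =
    node_msg \<beta> (\<lambda>_ _ _. False) Av w q j" for w r q j
    by (cases w) (simp only: node_msg_def Let_def node_view.simps)
  then show ?thesis by (simp add: deterministic_def sim_alg_def Let_def)
qed

lemma simulates_sim_alg:
  fixes Av :: "'i ma_algorithm"
  assumes bits: "bit_bounded b Av"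
    and G: "simple_graph G" "connected_graph G" and Gv: "virtual_graph G Gv"
    and card: "card (virtual_nodes G Gv) \<le> \<beta>" and ids: "\<forall>v\<in>verts Gv. length v \<le> b"
    and stored: "distributedly_stored G Gv inp st"
    and ext: "ext = split_tape \<or> deterministic Av \<and> ext = (\<lambda>_ _ _. False)"
  shows "simulates (sim_alg \<beta> b ext (trunc_ops b Av))
    (\<lambda>v i l. node_log_of \<beta> (set (virt_ids (snd i))) l (rounds Av)) Av G Gv inp st"
proof -
  obtain v0 where "v0 \<in> verts G" using G(2) by (auto simp: connected_graph_def)
  \<comment> \<open>This leader depends on \<open>G\<close> alone, so the coin map is fixed before
    the run; every phase elects it again (\<open>leader_elected\<close>).\<close>
  then obtain ldr where ldr: "ldr \<in> verts G" "\<And>v. v \<in> verts G \<Longrightarrow> to_nat ldr \<le> to_nat v"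
    using ex_has_least_nat[of "\<lambda>v. v \<in> verts G" v0 to_nat] by auto
  let ?\<Phi> = "coin_map G Gv ldr" and ?A = "sim_alg \<beta> b ext (trunc_ops b Av)"
  have sGv: "simple_graph Gv" using Gv by (simp add: virtual_graph_def)
  have "\<exists>cv. terminates_in Av Gv inp (?\<Phi> \<omega>) cv \<and> (\<forall>v\<in>verts G. \<forall>w\<in>insert v (virtual_nodes G Gv).
      node_log_of \<beta> (set (virt_ids (snd (inp v, st v)))) (nlog cT v) (rounds Av) w = nlog cv w)"
    if run: "terminates_in ?A G (\<lambda>u. (inp u, st u)) \<omega> cT" for \<omega> cT
  proof -
    obtain c where c: "c 0 = \<lparr>nlog = (\<lambda>_. []), elog = (\<lambda>_. [])\<rparr>" "c (rounds ?A) = cT"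
      "\<forall>t<rounds ?A. ma_round ?A G (\<lambda>u. (inp u, st u)) \<omega> t (c t) (c (Suc t))"
      using reaches_sequence[OF run[unfolded terminates_in_def]] by auto
    \<comment> \<open>In the deterministic case the simulated units see constant tapes instead of
      \<open>?\<Phi> \<omega>\<close>; \<open>reaches_deterministic\<close> closes the gap
      below.\<close>
    define \<omega>' where "\<omega>' = (if ext = split_tape then ?\<Phi> \<omega> else (\<lambda>_. False))"
    have coins: "(\<lambda>k. \<omega>' (x, k)) = ext (\<lambda>k. \<omega> (host G ldr x, k)) x" if "x \<in> units Gv" for x
      using ext that by (auto simp: \<omega>'_def coin_map_def split_tape_def)
    interpret sim_run G Gv ldr "trunc_ops b Av" \<beta> b ext inp st \<omega> \<omega>' c "rounds ?A"
      by unfold_locales (use G Gv ldr card bounded_trunc_ops[of b Av] bits ids stored coins c in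
        auto)
    obtain cv where cv: "reaches (trunc_ops b Av) Gv inp \<omega>' (rounds Av) cv" "agrees (rounds Av) cv"
      using simulation[of "rounds Av"] by (auto simp: sim_alg_def)
    have r: "reaches Av Gv inp \<omega>' (rounds Av) cv" by (rule reaches_trunc_ops[OF bits cv(1)])
    have "reaches Av Gv inp (?\<Phi> \<omega>) (rounds Av) cv"
      using r ext reaches_deterministic[OF _ r] by (cases "ext = split_tape") (auto simp: \<omega>'_def)
    moreover have "node_log_of \<beta> (set (virt_ids (snd (inp v, st v)))) (nlog cT v) (rounds Av) w =
      nlog cv w"
      if "v \<in> verts G" "w \<in> insert v (virtual_nodes G Gv)" for v w
    proof -
      have "v \<in> V" "w \<in> insert v W" using that by (auto simp: V_def W_def)
      then have "nlog cv w = node_log_of \<beta> W (NL v) (rounds Av) w"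
        using cv(2) unfolding agrees_def by blast
      then show ?thesis using storage(1)[OF \<open>v \<in> V\<close>] c(2) by (simp add: NL_def)
    qed
    ultimately show ?thesis unfolding terminates_in_def by blast
  qed
  then show ?thesis unfolding simulates_def
    using coin_map[OF sGv ldr(1)] by (intro bexI[of _ ?\<Phi>] conjI ballI allI impI) auto
qed

theorem theorem4p2:
  shows "\<exists>C :: nat. \<forall>B. soft_O_one B \<longrightarrow>
    (\<exists>B'. soft_O_one B' \<and>
      (\<forall>(n :: nat) (\<beta> :: nat) (\<tau> :: nat) (Av :: 'i ma_algorithm).
        rounds Av = \<tau> \<longrightarrow> bit_bounded (B n) Av \<longrightarrow>
        (\<exists>(A :: ('i \<times> 'i storage) ma_algorithm) dec.
          rounds A \<le> C * \<tau> * (\<beta> + 1) \<and> bit_bounded (B' n) A \<and>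
          (deterministic Av \<longrightarrow> deterministic A) \<and>
          (\<forall>G Gv inp st.
            simple_graph G \<longrightarrow> connected_graph G \<longrightarrow> card (verts G) = n \<longrightarrow>
            virtual_graph G Gv \<longrightarrow> card (virtual_nodes G Gv) \<le> \<beta> \<longrightarrow>
            (\<forall>v\<in>verts Gv. length v \<le> B n) \<longrightarrow>
            distributedly_stored G Gv inp st \<longrightarrow>
            simulates A dec Av G Gv inp st))))"
\<comment> \<open>5 because \<open>3 * \<beta> + 5 \<le> 5 * (\<beta> + 1)\<close>.\<close>
proof (intro exI[of _ 5] allI impI)
  fix B assume B: "soft_O_one B"
  show "\<exists>B'. soft_O_one B' \<and>
      (\<forall>(n :: nat) (\<beta> :: nat) (\<tau> :: nat) (Av :: 'i ma_algorithm).
        rounds Av = \<tau> \<longrightarrow> bit_bounded (B n) Av \<longrightarrow>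
        (\<exists>(A :: ('i \<times> 'i storage) ma_algorithm) dec.
          rounds A \<le> 5 * \<tau> * (\<beta> + 1) \<and> bit_bounded (B' n) A \<and>
          (deterministic Av \<longrightarrow> deterministic A) \<and>
          (\<forall>G Gv inp st.
            simple_graph G \<longrightarrow> connected_graph G \<longrightarrow> card (verts G) = n \<longrightarrow>
            virtual_graph G Gv \<longrightarrow> card (virtual_nodes G Gv) \<le> \<beta> \<longrightarrow>
            (\<forall>v\<in>verts Gv. length v \<le> B n) \<longrightarrow>
            distributedly_stored G Gv inp st \<longrightarrow>
            simulates A dec Av G Gv inp st)))"
  proof (intro exI[of _ "\<lambda>n. 3 * B n + 4"] conjI soft_O_one_linear[OF B] allI impI)
    fix n \<beta> \<tau> :: nat and Av :: "'i ma_algorithm"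
    assume Av: "rounds Av = \<tau>" "bit_bounded (B n) Av"
    \<comment> \<open>The choice depends on \<open>Av\<close> only, so that one algorithm serves all
      graphs of the given size.\<close>
    define ext where "ext = (if deterministic Av then (\<lambda>_ _ _. False) else split_tape)"
    define A where "A = sim_alg \<beta> (B n) ext (trunc_ops (B n) Av)"
    have "rounds A = \<tau> * (3 * \<beta> + 5)" using Av by (simp add: A_def sim_alg_def phase_len_def)
    also have "\<dots> \<le> 5 * \<tau> * (\<beta> + 1)" by (simp add: algebra_simps)
    finally have "rounds A \<le> 5 * \<tau> * (\<beta> + 1)" .
    moreover have "bit_bounded (3 * B n + 4) A"
      unfolding A_def by (intro bit_bounded_sim_alg bounded_trunc_ops Av)
    moreover have "deterministic Av \<longrightarrow> deterministic A"
      by (simp add: A_def ext_def deterministic_sim_alg)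
    moreover have "simulates A (\<lambda>v i l. node_log_of \<beta> (set (virt_ids (snd i))) l
      (rounds Av)) Av G Gv inp st"
      if "simple_graph G" "connected_graph G" "virtual_graph G Gv" "card (virtual_nodes G Gv) \<le> \<beta>"
        "\<forall>v\<in>verts Gv. length v \<le> B n" "distributedly_stored G Gv inp st" for G Gv inp st
      unfolding A_def by (rule simulates_sim_alg) (use that Av in \<open>auto simp: ext_def\<close>)
    ultimately show "\<exists>(A :: ('i \<times> 'i storage) ma_algorithm) dec.
          rounds A \<le> 5 * \<tau> * (\<beta> + 1) \<and> bit_bounded (3 * B n + 4) A \<and>
          (deterministic Av \<longrightarrow> deterministic A) \<and>
          (\<forall>G Gv inp st.
            simple_graph G \<longrightarrow> connected_graph G \<longrightarrow> card (verts G) = n \<longrightarrow>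
            virtual_graph G Gv \<longrightarrow> card (virtual_nodes G Gv) \<le> \<beta> \<longrightarrow>
            (\<forall>v\<in>verts Gv. length v \<le> B n) \<longrightarrow>
            distributedly_stored G Gv inp st \<longrightarrow>
            simulates A dec Av G Gv inp st)"
      by blast
  qed
qed

end
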